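(* Let $s\ge0$, let $(a_n)_{n=0}^\infty$ be a greedy $s$-energy sequence on $S^1$, and let $(F_{N,s})_{N\ge1}$ be the associated sequence. Let $F_s'$ be the set of limit points of $(F_{N,s})_{N=1}^\infty$, and let $T_s:=\left[\liminf_{N\to\infty}F_{N,s},\ \limsup_{N\to\infty}F_{N,s}\right]$, that is, \[ T_s=\begin{cases}[0,1], & s=0,\\ \left[2(2\pi)^{-s}\zeta(s),\ 2(2^s-1)(2\pi)^{-s}\zeta(s)\right], & s>0,\ s\neq1,\\ \left[\tfrac1\pi(\gamma+\log(2/\pi)),\ \tfrac1\pi(\gamma+\log(8/\pi))\right], & s=1.\end{cases} \] Then $F_s'=T_s$.
   Context: $S^1$ is the unit circle in $\mathbb{C}$. Let $K_s(x,y):=|x-y|^{-s}$ for $s>0$ and $K_0(x,y):=-\log|x-y|$ (with value $+\infty$ if $x=y$). A greedy $s$-energy sequence is a sequence $(a_n)_{n=0}^\infty\subset S^1$ with $a_0\in S^1$ arbitrary and, for each $n\ge1$, $a_n$ any point satisfying $\sum_{\ell=0}^{n-1}K_s(a_n,a_\ell)=\min_{x\in S^1}\sum_{\ell=0}^{n-1}K_s(x,a_\ell)$. Put $U_{N,s}(x):=\sum_{k=0}^{N-1}K_s(x,a_k)$, and \[ F_{N,s}:=\begin{cases}-\dfrac{U_{N,0}(a_N)}{\log(N+1)}, & s=0,\\[0.6em]\dfrac{U_{N,s}(a_N)-N I_s(\sigma)}{N^s}, & 0<s<1,\\[0.6em] \dfrac{U_{N,1}(a_N)-\pi^{-1}N\log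 N}{N}, & s=1,\\[0.6em] \dfrac{U_{N,s}(a_N)}{N^s}, & s>1,\end{cases} \] where, for $0<s<1$, $I_s(\sigma)=\iint_{S^1\times S^1}|x-y|^{-s}\,d\sigma(x)\,d\sigma(y)=\frac{2^{-s}}{\sqrt\pi}\frac{\Gamma(\frac{1-s}{2})}{\Gamma(1-\frac s2)}$ and $\sigma$ is the arclength measure on $S^1$ normalized to have total mass $1$. A limit point of a sequence $(x_N)$ is any value that is the limit of a subsequence of $(x_N)$. $\zeta$ is the Riemann zeta function (analytically continued) and $\gamma$ is the Euler–Mascheroni constant. *)

theory Defs
  imports "HOL-Complex_Analysis.Complex_Analysis"
begin

section \<open>The Riemann zeta function on the punctured right half-plane\<close>

definition zeta_domain :: "complex set" where
  "zeta_domain = {s. 0 < Re s} - {1}"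

definition is_zeta :: "(complex \<Rightarrow> complex) \<Rightarrow> bool" where
  "is_zeta f \<longleftrightarrow> f holomorphic_on zeta_domain \<and>
     (\<forall>s. 1 < Re s \<longrightarrow> (\<lambda>n. of_nat (Suc n) powr (-s)) sums f s)"

text \<open>
  The analytic continuation is only carried out as far as it is needed, namely to
  the half-plane \<open>Re s > 0\<close> with the pole \<open>s = 1\<close> removed. It exists and is
  unique there (\<open>is_zeta_exists\<close>, \<open>is_zeta_unique\<close>), so it agrees on this domain
  with the continuation to the whole punctured plane. The values of
  \<open>riemann_zeta\<close> outside \<open>zeta_domain\<close> are unspecified.
\<close>

definition riemann_zeta :: "complex \<Rightarrow> complex" where
  "riemann_zeta = (SOME f. is_zeta f)"

lemma open_zeta_domain: "open zeta_domain"
  unfolding zeta_domain_def by (intro open_Diff open_halfspace_Re_gt) auto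

lemma connected_zeta_domain: "connected zeta_domain"
  unfolding zeta_domain_def
  by (intro connected_open_delete open_halfspace_Re_gt convex_connected convex_halfspace_Re_gt) auto

lemma is_zeta_unique:
  assumes "is_zeta f" "is_zeta g" "s \<in> zeta_domain"
  shows "f s = g s"
proof -
  have *: "f z = g z" if "z \<in> {z. 1 < Re z}" for z
    using assms(1,2) that by (auto simp: is_zeta_def intro: sums_unique2)
  have "f s - g s = 0"
  proof (rule analytic_continuation[where f = "\<lambda>s. f s - g s" and S = zeta_domain
                                    and U = "{z. 1 < Re z}" and \<xi> = 2])
    show "(\<lambda>s. f s - g s) holomorphic_on zeta_domain"
      using assms by (intro holomorphic_intros) (auto simp: is_zeta_def)
    show "(2::complex) islimpt {z. 1 < Re z}"
      by (intro interior_limit_point) (simp add: interior_open open_halfspace_Re_gt)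
  qed (use assms * open_zeta_domain connected_zeta_domain in \<open>auto simp: zeta_domain_def\<close>)
  thus ?thesis by simp
qed

definition zeta_term :: "nat \<Rightarrow> complex \<Rightarrow> complex" where
  "zeta_term n s = of_nat (Suc n) powr (-s) -
     (of_nat (Suc (Suc n)) powr (1 - s) - of_nat (Suc n) powr (1 - s)) / (1 - s)"

lemma norm_zeta_term_le:
  assumes "s \<in> zeta_domain"
  shows "norm (zeta_term n s) \<le> norm s * real (Suc n) powr (- Re s - 1)"
proof -
  define a where "a = real (Suc n)"
  define S where "S = complex_of_real ` {a..a+1}"
  have a: "a \<ge> 1" by (simp add: a_def)
  have s: "Re s > 0" "s \<noteq> 1" using assms by (auto simp: zeta_domain_def)
  have cvS: "convex S"
    unfolding S_def by (intro convex_linear_image bounded_linear.linear bounded_linear_of_real) auto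
  have pos: "z \<notin> \<real>\<^sub>\<le>\<^sub>0" if "z \<in> S" for z
    using that a by (auto simp: S_def complex_nonpos_Reals_iff)
  have aS: "of_real a \<in> S" "of_real (a + 1) \<in> S"
    unfolding S_def by (rule imageI, simp)+
  define B where "B = norm s * a powr (- Re s - 1)"
  have B: "B \<ge> 0" by (simp add: B_def)
  have 1: "norm (z powr (-s) - of_real a powr (-s)) \<le> B" if z: "z \<in> S" for z
  proof -
    have "norm (z powr (-s) - of_real a powr (-s)) \<le> B * norm (z - of_real a)"
    proof (rule field_differentiable_bound[OF cvS _ _ z aS(1)])
      fix w assume w: "w \<in> S"
      show "((\<lambda>z. z powr (-s)) has_field_derivative (-s) * w powr (-s - 1)) (at w within S)"
        using has_field_derivative_powr[OF pos[OF w]] by (rule has_field_derivative_at_within)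
      obtain t where t: "w = of_real t" "t \<ge> a" using w by (auto simp: S_def)
      have "norm (w powr (-s - 1)) = t powr (- Re s - 1)"
        using t a by (simp add: norm_powr_real_powr)
      also have "\<dots> \<le> a powr (- Re s - 1)"
        using t a s by (intro powr_mono2') auto
      finally show "norm ((-s) * w powr (-s - 1)) \<le> B"
        by (simp add: norm_mult B_def mult_left_mono)
    qed
    moreover have "norm (z - of_real a) \<le> 1"
    proof -
      obtain t where "z = of_real t" "t \<in> {a..a+1}" using z by (auto simp: S_def)
      thus ?thesis by (simp flip: of_real_diff)
    qed
    ultimately show ?thesis using B by (meson mult_left_le order_trans)
  qed
  define h where "h = (\<lambda>z. z powr (1 - s) / (1 - s) - z * of_real a powr (-s))"
  have "norm (h (of_real (a + 1)) - h (of_real a)) \<le> B * norm (complex_of_real (a + 1) - of_real a)"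
  proof (rule field_differentiable_bound[OF cvS _ _ aS(2,1)])
    fix w assume w: "w \<in> S"
    have "((\<lambda>z. z powr (1 - s)) has_field_derivative (1 - s) * w powr (1 - s - 1)) (at w within S)"
      using has_field_derivative_powr[OF pos[OF w]] by (rule has_field_derivative_at_within)
    hence "((\<lambda>z. z powr (1 - s) / (1 - s)) has_field_derivative
             (1 - s) * w powr (1 - s - 1) / (1 - s)) (at w within S)"
      by (rule DERIV_cdivide)
    hence "((\<lambda>z. z powr (1 - s) / (1 - s)) has_field_derivative w powr (-s)) (at w within S)"
      using s by simp
    moreover have "((\<lambda>z. z * of_real a powr (-s)) has_field_derivative of_real a powr (-s)) (at w within S)"
      by (auto intro!: derivative_eq_intros)
    ultimately show "(h has_field_derivative w powr (-s) - of_real a powr (-s)) (at w within S)"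
      unfolding h_def by (rule DERIV_diff)
    show "norm (w powr (-s) - of_real a powr (-s)) \<le> B" by (rule 1[OF w])
  qed
  also have "norm (complex_of_real (a + 1) - of_real a) = 1" by simp
  also have "h (of_real (a + 1)) - h (of_real a) = - zeta_term n s"
    by (simp add: h_def zeta_term_def a_def algebra_simps diff_divide_distrib)
  finally show ?thesis by (simp add: B_def a_def)
qed

lemma summable_Suc_powr:
  assumes "r < -1"
  shows "summable (\<lambda>n. real (Suc n) powr r)"
  using assms summable_real_powr_iff[of r] by (subst summable_Suc_iff) auto

lemma is_zeta_exists: "\<exists>f. is_zeta f"
proof -
  define g where "g = (\<lambda>s. \<Sum>n. zeta_term n s)"
  define f where "f = (\<lambda>s. g s + 1 / (s - 1))"
  have hol_term: "zeta_term n holomorphic_on zeta_domain" for n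
    unfolding zeta_term_def by (intro holomorphic_intros) (auto simp: zeta_domain_def)
  have "g holomorphic_on zeta_domain"
  proof (rule holomorphic_uniform_sequence[OF open_zeta_domain])
    show "(\<lambda>s. \<Sum>i<n. zeta_term i s) holomorphic_on zeta_domain" for n
      by (intro holomorphic_intros hol_term)
  next
    fix z assume z: "z \<in> zeta_domain"
    then obtain e where e: "e > 0" "cball z e \<subseteq> zeta_domain"
      using open_zeta_domain open_contains_cball by blast
    define d where "d = min e (Re z / 2)"
    have rz: "Re z > 0" using z by (simp add: zeta_domain_def)
    have d: "d > 0" "cball z d \<subseteq> zeta_domain" using e rz by (auto simp: d_def)
    have "uniform_limit (cball z d) (\<lambda>n s. \<Sum>i<n. zeta_term i s) g sequentially"
      unfolding g_def
    proof (rule Weierstrass_m_test)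
      fix n s assume s: "s \<in> cball z d"
      have "norm (s - z) \<le> d" using s by (simp add: dist_norm norm_minus_commute)
      moreover have "\<bar>Re (s - z)\<bar> \<le> norm (s - z)" by (rule abs_Re_le_cmod)
      moreover have "d \<le> Re z / 2" by (simp add: d_def)
      ultimately have re: "Re s \<ge> Re z / 2" by simp
      have no: "norm s \<le> norm z + d"
        using norm_triangle_ineq[of "s - z" z] \<open>norm (s - z) \<le> d\<close> by simp
      have "norm (zeta_term n s) \<le> norm s * real (Suc n) powr (- Re s - 1)"
        using s d by (intro norm_zeta_term_le) auto
      also have "\<dots> \<le> (norm z + d) * real (Suc n) powr (- (Re z / 2) - 1)"
        using re no d(1) by (intro mult_mono powr_mono) auto
      finally show "norm (zeta_term n s) \<le> (norm z + d) * real (Suc n) powr (- (Re z / 2) - 1)" .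
    next
      show "summable (\<lambda>n. (norm z + d) * real (Suc n) powr (- (Re z / 2) - 1))"
        using rz by (intro summable_mult summable_Suc_powr) auto
    qed
    with d show "\<exists>d>0. cball z d \<subseteq> zeta_domain \<and>
        uniform_limit (cball z d) (\<lambda>n s. \<Sum>i<n. zeta_term i s) g sequentially" by blast
  qed
  hence "f holomorphic_on zeta_domain"
    unfolding f_def by (intro holomorphic_intros) (auto simp: zeta_domain_def)
  moreover have "(\<lambda>n. of_nat (Suc n) powr (-s)) sums f s" if s: "1 < Re s" for s
  proof -
    have dom: "s \<in> zeta_domain" "s \<noteq> 1" using s by (auto simp: zeta_domain_def)
    have "summable (\<lambda>n. norm s * real (Suc n) powr (- Re s - 1))"
      using s by (intro summable_mult summable_Suc_powr) auto
    hence "summable (\<lambda>n. zeta_term n s)"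
      by (rule summable_comparison_test') (use norm_zeta_term_le[OF dom(1)] in auto)
    hence 1: "(\<lambda>n. zeta_term n s) sums g s"
      unfolding g_def by (rule summable_sums)
    have "(\<lambda>n. real (Suc n) powr (1 - Re s)) \<longlonglongrightarrow> 0"
      using s by (intro tendsto_neg_powr filterlim_compose[OF filterlim_real_sequentially filterlim_Suc]) auto
    hence "(\<lambda>n. norm (complex_of_nat (Suc n) powr (1 - s))) \<longlonglongrightarrow> 0"
      by (simp add: norm_powr_real_powr del: of_nat_Suc)
    hence "(\<lambda>n. complex_of_nat (Suc n) powr (1 - s)) \<longlonglongrightarrow> 0"
      by (rule tendsto_norm_zero_cancel)
    from telescope_sums[OF this] have
      "(\<lambda>n. complex_of_nat (Suc (Suc n)) powr (1 - s) - of_nat (Suc n) powr (1 - s)) sums (-1)"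
      by simp
    from sums_add[OF 1 sums_divide[OF this, of "1 - s"]]
    have "(\<lambda>n. of_nat (Suc n) powr (-s)) sums (g s + (-1) / (1 - s))"
      by (simp add: zeta_term_def)
    also have "(-1) / (1 - s) = 1 / (s - 1)"
      using dom by (simp add: divide_simps)
    finally show ?thesis by (simp add: f_def)
  qed
  ultimately show ?thesis by (auto simp: is_zeta_def)
qed

lemma is_zeta_riemann_zeta: "is_zeta riemann_zeta"
  unfolding riemann_zeta_def using is_zeta_exists by (rule someI_ex)

section \<open>Greedy energy sequences on the unit circle\<close>

abbreviation unit_circle :: "complex set" where
  "unit_circle \<equiv> sphere 0 1"

definition riesz_kernel :: "real \<Rightarrow> complex \<Rightarrow> complex \<Rightarrow> ereal" where
  "riesz_kernel s x y =
     (if x = y then \<infinity>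
      else if s = 0 then ereal (- ln (dist x y))
      else ereal (dist x y powr (-s)))"

definition potential :: "real \<Rightarrow> (nat \<Rightarrow> complex) \<Rightarrow> nat \<Rightarrow> complex \<Rightarrow> ereal" where
  "potential s a N x = (\<Sum>k<N. riesz_kernel s x (a k))"

definition greedy_energy_sequence :: "real \<Rightarrow> (nat \<Rightarrow> complex) \<Rightarrow> bool" where
  "greedy_energy_sequence s a \<longleftrightarrow>
     (\<forall>n. a n \<in> unit_circle) \<and>
     (\<forall>n\<ge>1. \<forall>x\<in>unit_circle. potential s a n (a n) \<le> potential s a n x)"

definition circle_measure :: "complex measure" where
  "circle_measure = distr (uniform_measure lborel {0..2*pi}) borel cis"

text \<open>
  Used for \<open>0 < s < 1\<close> only, where the diagonal, on which the integrand below is 0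
  instead of \<open>\<infinity>\<close>, is a null set.
\<close>

definition riesz_energy :: "real \<Rightarrow> real" where
  "riesz_energy s = (\<integral>x. (\<integral>y. dist x y powr (-s) \<partial>circle_measure) \<partial>circle_measure)"

definition normalized_potential :: "real \<Rightarrow> (nat \<Rightarrow> complex) \<Rightarrow> nat \<Rightarrow> ereal" where
  "normalized_potential s a N =
     (if s = 0 then - potential s a N (a N) / ereal (ln (real N + 1))
      else if s < 1 then (potential s a N (a N) - ereal (real N * riesz_energy s)) / ereal (real N powr s)
      else if s = 1 then (potential s a N (a N) - ereal (1 / pi * real N * ln (real N))) / ereal (real N)
      else potential s a N (a N) / ereal (real N powr s))"

definition limit_points :: "(nat \<Rightarrow> ereal) \<Rightarrow> ereal set" where
  "limit_points X = {l. \<exists>r. strict_mono r \<and> (X \<circ> r) \<longlonglongrightarrow> l}"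

definition limit_interval :: "real \<Rightarrow> real set" where
  "limit_interval s =
     (if s = 0 then {0..1}
      else if s = 1 then {1 / pi * (euler_mascheroni + ln (2 / pi)) .. 1 / pi * (euler_mascheroni + ln (8 / pi))}
      else {2 * (2 * pi) powr (-s) * Re (riemann_zeta (of_real s)) ..
            2 * (2 powr s - 1) * (2 * pi) powr (-s) * Re (riemann_zeta (of_real s))})"

end

theory Submission
  imports Defs
begin

text \<open>
  The proof rests on the binary structure of greedy sequences. The potential of a regular \<open>M\<close>-gon on the
  circle is minimal exactly at the midpoints of the arcs (\<open>polygon_potential_greater\<close>), because the
  kernel is a strictly convex function of the angle. It follows by induction that the first \<open>2 ^ n\<close>
  points of a greedy sequence form a regular polygon, and that the next points sit on arc midpoints
  of it, where they minimize the potential of the polygon and at the same time form a greedy sequence of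
  their own (\<open>greedy_second_block\<close>). Therefore the potential \<open>U N (a N)\<close> does not depend on the choices
  made. It is the sum, over the binary digits \<open>2 ^ n\<close> of \<open>N\<close>, of the potentials of regular \<open>2 ^ n\<close>-gons at
  their arc midpoints (\<open>greedy_potential\<close>).

  The latter are, up to lower order, \<open>I * 2 ^ n + B * 2 ^ (n * s)\<close> for \<open>s < 1\<close>, with the energy \<open>I\<close> of the
  circle and a multiple \<open>B\<close> of \<open>\<zeta>(s)\<close>, \<open>B * 2 ^ (n * s)\<close> for \<open>s > 1\<close>, and
  \<open>B * 2 ^ n + 2 ^ n * ln (2 ^ n) / pi\<close> for \<open>s = 1\<close>. For \<open>s \<le> 1\<close> this is obtained by subtracting the
  singularity of the kernel: the singular part gives partial sums of the zeta or harmonic series, and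
  the rest is a monotone function whose Riemann sums converge quickly
  (\<open>midpoint_potential_remainder\<close>). For \<open>s > 1\<close> the leading term comes from dominated convergence.

  So the normalized potential is, up to terms tending to zero, \<open>B\<close> plus a nonnegative multiple of
  \<open>((\<Sum>k. \<phi> (2 ^ n\<^sub>k)) - \<phi> N) / N powr s\<close>, where \<open>N = (\<Sum>k. 2 ^ n\<^sub>k)\<close> is the binary expansion and \<open>\<phi>\<close> is one of the convex functions \<open>x powr s\<close>, \<open>x * ln x\<close> and \<open>- (x powr s)\<close>. Convexity bounds it from
  above by its limit along \<open>N = 2 ^ n\<close>, and from below by its limit along \<open>N = 2 ^ n - 1\<close>
  (\<open>binsum_convex_le\<close>, \<open>binsum_convex_ge\<close>). That nothing in between is missed follows from the greedy
  choice itself: \<open>U N (a N)\<close> increases with \<open>N\<close> for \<open>s > 0\<close>, hence the downward steps of the normalized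
  potential tend to zero, and a discrete intermediate value argument between \<open>2 ^ n\<close> and
  \<open>2 ^ (n + 1) - 1\<close> shows that every value of the interval is approached (\<open>dyadic_limit_interval\<close>). For
  \<open>s = 0\<close> all polygons contribute \<open>- ln 2\<close>, and the same reasoning applies to the number of digits \<open>1\<close>
  relative to the length of the binary expansion.
\<close>

section \<open>Sums over the binary digits of a number\<close>

definition binsum :: "(nat \<Rightarrow> real) \<Rightarrow> nat \<Rightarrow> real" where
  "binsum w N = (\<Sum>n | bit N n. w n)"

lemma bit_add_exp_iff:
  fixes j :: nat
  assumes "j < 2 ^ n"
  shows "bit (2 ^ n + j) i \<longleftrightarrow> i = n \<or> bit j i"
proof -
  have nb: "\<not> bit j n" using assms by (simp add: bit_iff_odd)
  have "2 ^ n + j = or (2 ^ n) j"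
    by (rule disjunctive_add_eq_or) (use nb in \<open>auto intro!: bit_eqI simp: bit_simps\<close>)
  thus ?thesis by (auto simp: bit_simps)
qed

lemma finite_bits: "finite {n. bit (N::nat) n}"
proof (rule finite_subset)
  show "{n. bit N n} \<subseteq> {..N}"
  proof
    fix n assume "n \<in> {n. bit N n}"
    hence "2 ^ n \<le> N" by (simp add: bit_iff_odd) (metis div_less even_zero not_le)
    thus "n \<in> {..N}" by (meson atMost_iff less_exp less_le_trans less_imp_le)
  qed
qed auto

lemma binsum_0 [simp]: "binsum w 0 = 0"
  by (simp add: binsum_def)

lemma binsum_exp_add:
  assumes "j < 2 ^ n"
  shows "binsum w (2 ^ n + j) = w n + binsum w j"
proof -
  have "{i. bit (2 ^ n + j) i} = insert n {i. bit j i}"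
    using bit_add_exp_iff[OF assms] by auto
  moreover have "n \<notin> {i. bit j i}" using assms by (simp add: bit_iff_odd)
  ultimately show ?thesis by (simp add: binsum_def finite_bits)
qed

lemma binary_cases:
  assumes "N > (0::nat)"
  obtains n j where "N = 2 ^ n + j" "j < 2 ^ n"
proof -
  obtain n where "2 ^ n \<le> N" "N < 2 ^ (n + 1)"
    using ex_power_ivl1[of 2 N] assms by auto
  thus ?thesis using that[of n "N - 2 ^ n"] by auto
qed

lemma binary_induct [case_names zero add]:
  assumes "P 0" "\<And>n j. j < 2 ^ n \<Longrightarrow> P j \<Longrightarrow> P (2 ^ n + j)"
  shows "P (N::nat)"
proof (induction N rule: less_induct)
  case (less N)
  show ?case
  proof (cases "N = 0")
    case False
    then obtain n j where "N = 2 ^ n + j" "j < 2 ^ n" by (metis binary_cases gr0I)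
    thus ?thesis using assms(2)[of j n] less[of j] by auto
  qed (use assms(1) in auto)
qed

lemma binsum_exp: "binsum w (2 ^ n) = w n"
  using binsum_exp_add[of 0 n w] by simp

lemma binsum_mask: "binsum w (2 ^ n - 1) = (\<Sum>k<n. w k)"
proof (induction n)
  case (Suc n)
  have "(2::nat) ^ Suc n - 1 = 2 ^ n + (2 ^ n - 1)" by simp
  thus ?case using Suc binsum_exp_add[of "2 ^ n - 1" n w] by simp
qed simp

lemma binsum_add: "binsum (\<lambda>n. v n + w n) N = binsum v N + binsum w N"
  by (simp add: binsum_def sum.distrib)

lemma binsum_mult: "binsum (\<lambda>n. c * w n) N = c * binsum w N"
  by (simp add: binsum_def sum_distrib_left)

lemma binsum_two_power: "binsum (\<lambda>n. 2 ^ n) N = real N"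
  by (induction N rule: binary_induct) (simp_all add: binsum_exp_add)

text \<open>
  Comparison with a function \<open>G\<close> of the number itself: it suffices to control the increment of
  \<open>G\<close> caused by adding the leading binary digit, since digits can be peeled off one at a time.
\<close>

lemma binsum_le:
  assumes "G 0 \<ge> 0" "\<And>n j. j < 2 ^ n \<Longrightarrow> w n + G j \<le> G (2 ^ n + j)"
  shows "binsum w N \<le> G N"
proof (induction N rule: binary_induct)
  case (add n j)
  thus ?case using assms(2)[of j n] by (simp add: binsum_exp_add)
qed (use assms in auto)

text \<open>
  Spreading two points apart while keeping their sum does not decrease the sum of the values
  of a convex function.
\<close>

lemma convex_on_majorization:
  fixes f :: "real \<Rightarrow> real"
  assumes "convex_on S f" "p \<in> S" "q \<in> S" "p \<le> x" "x \<le> q" "x + y = p + q"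
  shows "f x + f y \<le> f p + f q"
proof (cases "p = q")
  case False
  define u where "u = (x - p) / (q - p)"
  have d: "q - p > 0" using assms False by auto
  have u: "0 \<le> u" "u \<le> 1" using assms d by (auto simp: u_def divide_simps)
  have upq: "u * (q - p) = x - p" using d by (simp add: u_def)
  have x: "x = (1 - u) * p + u * q" using upq by (simp add: algebra_simps)
  have y: "y = (1 - (1 - u)) * p + (1 - u) * q" using upq assms(6) by (simp add: algebra_simps)
  have "f x \<le> (1 - u) * f p + u * f q"
    using convex_onD[OF assms(1), of u p q] u assms by (simp add: x)
  moreover have "f y \<le> (1 - (1 - u)) * f p + (1 - u) * f q"
    using convex_onD[OF assms(1), of "1 - u" p q] u assms by (subst y) (simp add: algebra_simps)
  ultimately show ?thesis by (simp add: algebra_simps)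
qed (use assms in auto)

text \<open>
  The two estimates here and in \<open>binsum_convex_ge\<close> are the two endpoints of the interval of limit
  points. By convexity, the increment of \<open>\<phi>\<close> over a step of length \<open>2 ^ n\<close> started at \<open>j \<in> [0, 2 ^ n]\<close>
  lies between its values at the extreme positions \<open>j = 0\<close> and \<open>j = 2 ^ n\<close>, that is,
  \<open>\<phi> (2 ^ n) \<le> \<phi> (2 ^ n + j) - \<phi> j \<le> \<phi> (2 ^ (n + 1)) - \<phi> (2 ^ n)\<close>. The first estimate is an equality for
  powers of two; in the second one the sum telescopes for \<open>N = 2 ^ n - 1\<close>.
\<close>

lemma binsum_convex_le:
  assumes "convex_on {0..} \<phi>" "\<phi> 0 = 0"
  shows "binsum (\<lambda>n. \<phi> (2 ^ n)) N \<le> \<phi> (real N)"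
proof (rule binsum_le)
  fix n j :: nat assume "j < 2 ^ n"
  have "\<phi> (2 ^ n) + \<phi> (real j) \<le> \<phi> 0 + \<phi> (2 ^ n + real j)"
    by (rule convex_on_majorization[OF assms(1)]) auto
  thus "\<phi> (2 ^ n) + \<phi> (real j) \<le> \<phi> (real (2 ^ n + j))"
    by (simp add: assms(2))
qed (use assms in auto)

lemma binsum_convex_ge:
  assumes "convex_on {0..} \<phi>" "\<phi> 0 = 0"
  shows "\<phi> (real N) \<le> binsum (\<lambda>n. \<phi> (2 ^ Suc n) - \<phi> (2 ^ n)) N"
proof -
  have "binsum (\<lambda>n. - (\<phi> (2 ^ Suc n) - \<phi> (2 ^ n))) N \<le> - \<phi> (real N)"
  proof (rule binsum_le)
    fix n j :: nat assume j: "j < 2 ^ n"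
    have "real j < 2 ^ n" using j by (metis of_nat_less_iff of_nat_numeral of_nat_power)
    thus "- (\<phi> (2 ^ Suc n) - \<phi> (2 ^ n)) + - \<phi> (real j) \<le> - \<phi> (real (2 ^ n + j))"
      using convex_on_majorization[OF assms(1), of "real j" "2 ^ Suc n" "2 ^ n" "real (2 ^ n + j)"]
      by simp
  qed (use assms in auto)
  thus ?thesis using binsum_mult[of "-1" "\<lambda>n. \<phi> (2 ^ Suc n) - \<phi> (2 ^ n)" N] by simp
qed

text \<open>
  The digit weights of order \<open>2 ^ (n * s)\<close> form a geometric progression, so their sum is comparable
  to its leading term, which is at most \<open>N powr s\<close>; an error that is small relative to each weight
  is therefore small relative to \<open>N powr s\<close>.
\<close>

lemma binsum_small_o:
  assumes "s > 0" and e: "(\<lambda>n. e n / (2 ^ n) powr s) \<longlonglongrightarrow> 0"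
  shows "(\<lambda>N. binsum e N / real N powr s) \<longlonglongrightarrow> 0"
proof (rule tendstoI)
  fix \<epsilon> :: real assume eps: "\<epsilon> > 0"
  define r where "r = 2 powr s"
  have r: "r > 1" using assms by (simp add: r_def)
  have pw: "(2 ^ n) powr s = r ^ n" for n :: nat
    by (simp add: r_def powr_power powr_realpow[symmetric] powr_powr mult.commute)
  (* Chosen such that \<delta> times the geometric sum 1 + r + ... + r ^ n is at most \<epsilon> / 2 * r ^ n. *)
  define \<delta> where "\<delta> = \<epsilon> * (r - 1) / (2 * r)"
  have \<delta>: "\<delta> > 0" using eps r by (simp add: \<delta>_def)
  obtain k0 where k0: "\<And>n. n \<ge> k0 \<Longrightarrow> \<bar>e n\<bar> \<le> \<delta> * r ^ n"
  proof -
    have "eventually (\<lambda>n. \<bar>e n / r ^ n\<bar> < \<delta>) sequentially"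
      using tendstoD[OF e \<delta>] by (simp add: pw)
    then obtain k0 where "\<And>n. n \<ge> k0 \<Longrightarrow> \<bar>e n / r ^ n\<bar> < \<delta>"
      by (auto simp: eventually_at_top_linorder)
    moreover have "\<bar>e n\<bar> \<le> \<delta> * r ^ n" if "\<bar>e n / r ^ n\<bar> < \<delta>" for n
      using that r by (simp add: abs_div field_simps)
    ultimately show ?thesis using that by blast
  qed
  define D where "D = (\<Sum>k<k0. \<bar>e k\<bar>)"
  have bound: "\<bar>binsum e N\<bar> \<le> D + \<epsilon> / 2 * real N powr s" if N: "N > 0" for N
  proof -
    obtain n j where nj: "N = 2 ^ n + j" "j < 2 ^ n" using binary_cases[OF N] .
    have sub: "{k. bit N k} \<subseteq> {..n}"
    proof
      fix k assume k: "k \<in> {k. bit N k}"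
      have "k \<le> n"
      proof (rule ccontr)
        assume "\<not> k \<le> n"
        hence "(2::nat) ^ Suc n \<le> 2 ^ k" by (intro power_increasing) auto
        hence "N < 2 ^ k" using nj by simp
        thus False using k by (simp add: bit_iff_odd)
      qed
      thus "k \<in> {..n}" by simp
    qed
    have "\<bar>binsum e N\<bar> \<le> (\<Sum>k | bit N k. \<bar>e k\<bar>)" unfolding binsum_def by (rule sum_abs)
    also have "\<dots> \<le> (\<Sum>k\<le>n. \<bar>e k\<bar>)" by (rule sum_mono2) (use sub in auto)
    also have "\<dots> \<le> (\<Sum>k\<le>n. (if k < k0 then \<bar>e k\<bar> else 0) + \<delta> * r ^ k)"
      using k0 \<delta> r by (intro sum_mono) (auto simp: not_less)
    also have "\<dots> = (\<Sum>k | k \<in> {..n} \<and> k < k0. \<bar>e k\<bar>) + \<delta> * (\<Sum>k\<le>n. r ^ k)"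
      by (simp add: sum.distrib sum_distrib_left sum.If_cases Int_def)
    also have "(\<Sum>k | k \<in> {..n} \<and> k < k0. \<bar>e k\<bar>) \<le> D"
      unfolding D_def by (rule sum_mono2) auto
    also have "(\<Sum>k\<le>n. r ^ k) = (r ^ Suc n - 1) / (r - 1)"
      using geometric_sum[of r "Suc n"] r by (simp add: lessThan_Suc_atMost)
    also have "\<delta> * \<dots> \<le> \<delta> * (r ^ Suc n / (r - 1))"
      using \<delta> r by (intro mult_left_mono divide_right_mono) auto
    also have "\<dots> = \<epsilon> / 2 * r ^ n" using r by (simp add: \<delta>_def field_simps)
    also have "r ^ n \<le> real N powr s"
      unfolding pw[symmetric] using nj assms by (intro powr_mono2) auto
    finally show ?thesis using eps by (simp add: mult_left_mono)
  qed
  have "(\<lambda>N. D / real N powr s) \<longlonglongrightarrow> 0"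
    using assms by real_asymp
  hence "eventually (\<lambda>N. \<bar>D / real N powr s\<bar> < \<epsilon> / 2) sequentially"
    using eps by (auto dest!: tendstoD[where e = "\<epsilon> / 2"])
  moreover have "eventually (\<lambda>N::nat. N > 0) sequentially" by (rule eventually_gt_at_top)
  ultimately show "eventually (\<lambda>N. dist (binsum e N / real N powr s) 0 < \<epsilon>) sequentially"
  proof eventually_elim
    case (elim N)
    have "real N powr s > 0" using elim by simp
    thus ?case using bound[of N] elim by (simp add: abs_div field_simps)
  qed
qed

section \<open>The potential of the vertices of a regular polygon\<close>

definition kernel_profile :: "real \<Rightarrow> real \<Rightarrow> real" where
  "kernel_profile s d = (if s = 0 then - ln d else d powr (-s))"

text \<open>
  The potential of the \<open>M\<close>-th roots of unity at the midpoint of an arc between two neighbouring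
  roots, where the chords have the lengths \<open>2 * sin (pi * (2 * k + 1) / (2 * M))\<close>.
\<close>

definition midpoint_potential :: "real \<Rightarrow> nat \<Rightarrow> real" where
  "midpoint_potential s M = (\<Sum>k<M. kernel_profile s (2 * sin (pi * (2 * real k + 1) / (2 * real M))))"

lemma riesz_kernel_eq:
  "riesz_kernel s x y = (if x = y then \<infinity> else ereal (kernel_profile s (dist x y)))"
  by (simp add: riesz_kernel_def kernel_profile_def)

lemma riesz_kernel_neq_MInf [simp]: "riesz_kernel s x y \<noteq> -\<infinity>"
  by (simp add: riesz_kernel_eq)

text \<open>
  The kernel is log-convex in the sense that replacing two distances by one exceeding their
  geometric mean lowers the energy. For \<open>s = 0\<close> this is monotonicity of the logarithm; for \<open>s > 0\<close> the
  inequality of arithmetic and geometric means comes on top.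
\<close>

lemma kernel_profile_midpoint_less:
  assumes "s \<ge> 0" "d1 > 0" "d2 > 0" "d > 0" "d1 * d2 < d ^ 2"
  shows "2 * kernel_profile s d < kernel_profile s d1 + kernel_profile s d2"
proof (cases "s = 0")
  case True
  have "ln (d1 * d2) < ln (d ^ 2)" using assms by (subst ln_less_cancel_iff) auto
  thus ?thesis using assms True by (simp add: kernel_profile_def ln_mult ln_realpow)
next
  case False
  define p where "p = d1 powr (-s/2)"
  define q where "q = d2 powr (-s/2)"
  have "2 * d powr (-s) = 2 * (d ^ 2) powr (-s/2)"
  proof -
    have "d ^ 2 = d powr 2" using assms by simp
    thus ?thesis by (simp only: powr_powr) simp
  qed
  also have "\<dots> < 2 * (d1 * d2) powr (-s/2)"
    using assms False by (simp add: powr_less_mono2_neg)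
  also have "\<dots> = 2 * p * q" using assms by (simp add: p_def q_def powr_mult)
  also have "\<dots> \<le> p ^ 2 + q ^ 2" by (rule sum_squares_bound)
  also have "\<dots> = d1 powr (-s) + d2 powr (-s)"
    using assms by (simp add: p_def q_def power2_eq_square flip: powr_add)
  finally show ?thesis using False by (simp add: kernel_profile_def)
qed

text \<open>
  Together with \<open>kernel_profile_midpoint_less\<close> this says that the kernel is strictly midpoint
  convex as a function of the angle. It holds because
  \<open>2 * sin a * sin b = cos (a - b) - cos (a + b)\<close> is largest for \<open>a = b\<close> when \<open>a + b\<close> is given.
\<close>

lemma sin_mult_less_midpoint:
  fixes a b :: real
  assumes "a \<in> {0<..<pi}" "b \<in> {0<..<pi}" "a \<noteq> b"
  shows "(2 * sin a) * (2 * sin b) < (2 * sin ((a + b) / 2)) ^ 2"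
proof -
  have "cos (a - b) < 1"
  proof -
    have "cos \<bar>a - b\<bar> < cos 0" using assms by (subst cos_mono_less_eq) auto
    thus ?thesis by simp
  qed
  have "(2 * sin a) * (2 * sin b) = 2 * (cos (a - b) - cos (a + b))"
    by (simp add: cos_diff cos_add)
  also have "\<dots> < 2 * (1 - cos (a + b))" using \<open>cos (a - b) < 1\<close> by simp
  also have "cos (a + b) = 1 - 2 * (sin ((a + b) / 2)) ^ 2"
    using cos_double_sin[of "(a + b) / 2"] by (simp only: mult_2 field_sum_of_halves)
  finally show ?thesis by (simp add: power_mult_distrib)
qed

text \<open>
  Here \<open>\<eta>\<close> is half the angle from the preceding vertex of the polygon to the point at which the
  potential is evaluated, because an angle \<open>t\<close> belongs to a chord of length \<open>2 * sin (t / 2)\<close>.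
\<close>

definition polygon_potential :: "real \<Rightarrow> nat \<Rightarrow> real \<Rightarrow> real" where
  "polygon_potential s M \<eta> = (\<Sum>k<M. kernel_profile s (2 * sin (\<eta> + pi * real k / real M)))"

lemma polygon_potential_reflect:
  assumes "M > 0"
  shows "polygon_potential s M (pi / real M - \<eta>) = polygon_potential s M \<eta>"
proof -
  have "polygon_potential s M (pi / real M - \<eta>) =
          (\<Sum>k<M. kernel_profile s (2 * sin (pi / real M - \<eta> + pi * real (M - Suc k) / real M)))"
    unfolding polygon_potential_def by (rule sum.nat_diff_reindex[symmetric])
  also have "\<dots> = polygon_potential s M \<eta>" unfolding polygon_potential_def
  proof (rule sum.cong[OF refl])
    fix k assume "k \<in> {..<M}"
    hence "pi / real M - \<eta> + pi * real (M - Suc k) / real M = pi - (\<eta> + pi * real k / real M)"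
      using assms by (simp add: of_nat_diff field_simps)
    thus "kernel_profile s (2 * sin (pi / real M - \<eta> + pi * real (M - Suc k) / real M)) =
      kernel_profile s (2 * sin (\<eta> + pi * real k / real M))" by (simp only: sin_pi_minus)
  qed
  finally show ?thesis .
qed

lemma polygon_potential_midpoint:
  "polygon_potential s M (pi / (2 * real M)) = midpoint_potential s M"
  unfolding polygon_potential_def midpoint_potential_def
  by (intro sum.cong refl) (simp add: field_simps)

lemma polygon_angle:
  assumes "k < M" "\<eta> \<in> {0<..<pi / real M}"
  shows "\<eta> + pi * real k / real M \<in> {0<..<pi}"
proof -
  have "pi / real M + pi * real k / real M = pi * (real (Suc k) / real M)"
    using assms by (simp add: field_simps)
  also have "\<dots> \<le> pi * 1" using assms by (intro mult_left_mono) auto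
  finally have "\<eta> + pi * real k / real M < pi" using assms by auto
  moreover have "pi * real k / real M \<ge> 0" by simp
  ultimately show ?thesis using assms by (auto intro: add_pos_nonneg)
qed

text \<open>
  Averaging the potential at \<open>\<eta>\<close> with its equal value at the mirror image \<open>pi / M - \<eta>\<close> pairs up
  half-angles whose means are exactly those of the arc midpoint, so strict midpoint convexity
  applies term by term.
\<close>

lemma polygon_potential_greater:
  assumes "s \<ge> 0" "\<eta> \<in> {0<..<pi / real M}" "\<eta> \<noteq> pi / (2 * real M)"
  shows "polygon_potential s M \<eta> > midpoint_potential s M"
proof -
  have M: "M > 0" using assms(2) by (cases M) auto
  define \<eta>' where "\<eta>' = pi / real M - \<eta>"
  have \<eta>': "\<eta>' \<in> {0<..<pi / real M}" using assms by (auto simp: \<eta>'_def)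
  define f where "f = (\<lambda>\<eta> k. kernel_profile s (2 * sin (\<eta> + pi * real k / real M)))"
  have "(\<Sum>k<M. 2 * f (pi / (2 * real M)) k) < (\<Sum>k<M. f \<eta> k + f \<eta>' k)"
  proof (rule sum_strict_mono)
    fix k assume k: "k \<in> {..<M}"
    define a b where "a = \<eta> + pi * real k / real M" and "b = \<eta>' + pi * real k / real M"
    have a: "a \<in> {0<..<pi}" unfolding a_def by (rule polygon_angle) (use k assms in auto)
    have b: "b \<in> {0<..<pi}" unfolding b_def by (rule polygon_angle) (use k \<eta>' in auto)
    have "a \<noteq> b" using assms M by (auto simp: a_def b_def \<eta>'_def field_simps)
    from sin_mult_less_midpoint[OF a b this]
    have "2 * kernel_profile s (2 * sin ((a + b) / 2)) <
            kernel_profile s (2 * sin a) + kernel_profile s (2 * sin b)"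
      using a b assms by (intro kernel_profile_midpoint_less) (auto intro!: mult_pos_pos sin_gt_zero)
    moreover have "(a + b) / 2 = pi / (2 * real M) + pi * real k / real M"
      by (simp add: a_def b_def \<eta>'_def add_divide_distrib)
    ultimately show "2 * f (pi / (2 * real M)) k < f \<eta> k + f \<eta>' k"
      unfolding f_def a_def[symmetric] b_def[symmetric] by (simp only:)
  qed (use M in auto)
  also have "(\<Sum>k<M. f \<eta> k + f \<eta>' k) = 2 * polygon_potential s M \<eta>"
    using polygon_potential_reflect[OF M, of s \<eta>]
    by (simp add: sum.distrib f_def polygon_potential_def \<eta>'_def)
  also have "(\<Sum>k<M. 2 * f (pi / (2 * real M)) k) = 2 * midpoint_potential s M"
    unfolding polygon_potential_midpoint[symmetric]
    by (simp add: sum_distrib_left f_def polygon_potential_def)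
  finally show ?thesis by simp
qed

lemma dist_cis_rotate:
  assumes "norm x = 1" "t \<in> {0..2 * pi}"
  shows "dist x (x * cis (-t)) = 2 * sin (t / 2)"
proof -
  have "dist x (x * cis (-t)) = norm (x * (1 - cis (-t)))" by (simp add: dist_norm algebra_simps)
  also have "\<dots> = norm (1 - cis (-t))" using assms by (simp add: norm_mult)
  also have "1 - cis (-t) = cis (-t/2) * (2 * \<i> * sin (t/2))"
  proof -
    have "1 - cis (-t) = cis (-t/2) * (cis (t/2) - cis (-t/2))"
      by (simp add: right_diff_distrib cis_mult)
    also have "cis (t/2) - cis (-t/2) = 2 * \<i> * sin (t/2)" by (simp add: complex_eq_iff)
    finally show ?thesis .
  qed
  also have "norm \<dots> = 2 * \<bar>sin (t/2)\<bar>" by (simp add: norm_mult)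
  also have "\<bar>sin (t/2)\<bar> = sin (t/2)" using assms by (intro abs_of_nonneg sin_ge_zero) auto
  finally show ?thesis .
qed

lemma norm_eq_1_if_power:
  assumes "norm (x ^ M) = (1::real)" "M > 0"
  shows "norm (x :: complex) = 1"
  using assms power_eq_iff_eq_base[of M "norm x" 1] by (simp add: norm_power)

text \<open>
  For \<open>M > 0\<close> and a unimodular \<open>c\<close>, the vertices of a regular \<open>M\<close>-gon inscribed in the unit circle;
  the midpoints of its arcs are the points \<open>x\<close> with \<open>x ^ M = - c\<close>.
\<close>

definition polygon :: "nat \<Rightarrow> complex \<Rightarrow> complex set" where
  "polygon M c = {w. w ^ M = c}"

lemma polygon_subset_circle:
  assumes "M > 0" "norm c = 1" "w \<in> polygon M c"
  shows "norm w = 1"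
  using assms norm_eq_1_if_power[of w M] by (simp add: polygon_def)

lemma finite_polygon: "M > 0 \<Longrightarrow> norm c = 1 \<Longrightarrow> finite (polygon M c)"
  unfolding polygon_def by (intro finite_nth_roots) auto

lemma card_polygon: "M > 0 \<Longrightarrow> norm c = 1 \<Longrightarrow> card (polygon M c) = M"
  unfolding polygon_def by (intro card_nth_roots) auto

text \<open>
  Seen from \<open>x\<close>, the vertices lie at the angles \<open>- (\<beta> + 2 * pi * k) / M\<close> with \<open>k < M\<close>.
\<close>

lemma sum_polygon_eq:
  assumes M: "M > 0" and c: "norm c = 1" and x: "norm x = 1"
    and \<beta>: "\<beta> \<in> {0<..<2 * pi}" "x ^ M = c * cis \<beta>"
  shows "(\<Sum>w\<in>polygon M c. riesz_kernel s x w) = ereal (polygon_potential s M (\<beta> / (2 * real M)))"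
proof -
  define t where "t = (\<lambda>k. 2 * (\<beta> / (2 * real M) + pi * real k / real M))"
  define w where "w = (\<lambda>k. x * cis (- t k))"
  have t: "t k \<in> {0<..<2 * pi}" if "k < M" for k
  proof -
    have "\<beta> / (2 * real M) \<in> {0<..<pi / real M}" using \<beta> M by (auto simp: field_simps)
    from polygon_angle[OF that this] show ?thesis by (auto simp: t_def)
  qed
  have d: "dist x (w k) = 2 * sin (\<beta> / (2 * real M) + pi * real k / real M)" if "k < M" for k
  proof -
    have "dist x (w k) = 2 * sin (t k / 2)"
      unfolding w_def using x t[OF that] by (intro dist_cis_rotate) auto
    thus ?thesis by (simp only: t_def nonzero_mult_div_cancel_left)
  qed
  have dpos: "dist x (w k) > 0" if "k < M" for k
    using t[OF that] unfolding d[OF that] by (intro mult_pos_pos sin_gt_zero) (auto simp: t_def)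
  have inj: "inj_on w {..<M}"
  proof (rule inj_onI)
    fix j k assume jk: "j \<in> {..<M}" "k \<in> {..<M}" "w j = w k"
    have "cis (- t j) = cis (- t k)" using jk(3) x by (auto simp: w_def)
    hence "cis (t j) = cis (t k)" by (metis cis_inverse inverse_inverse_eq)
    moreover have "Arg2pi (cis (t i)) = t i" if "i < M" for i
      by (rule Arg2pi_unique[of 1]) (use t[OF that] in \<open>auto simp: cis_conv_exp\<close>)
    ultimately have "t j = t k" using jk by (metis lessThan_iff)
    thus "j = k" using M by (auto simp: t_def)
  qed
  have sub: "w ` {..<M} \<subseteq> polygon M c"
  proof (intro image_subsetI)
    fix k assume "k \<in> {..<M}"
    have "w k ^ M = x ^ M * cis (real M * (- t k))" by (simp only: w_def power_mult_distrib Complex.DeMoivre)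
    also have "real M * (- t k) = - \<beta> + (- (2 * pi * real k))"
      using M by (simp add: t_def field_simps)
    also have "cis (- \<beta> + (- (2 * pi * real k))) = cis (- \<beta>) * cis (- (2 * pi * real k))"
      by (simp add: cis_mult)
    also have "cis (- (2 * pi * real k)) = 1"
      by (metis cis_cnj cis_multiple_2pi complex_cnj_one Ints_of_nat)
    finally show "w k \<in> polygon M c" using \<beta> by (simp add: polygon_def cis_mult)
  qed
  have "w ` {..<M} = polygon M c"
    by (rule card_subset_eq[OF finite_polygon[OF M c] sub]) (simp add: card_polygon M c card_image inj)
  hence "(\<Sum>w\<in>polygon M c. riesz_kernel s x w) = (\<Sum>k<M. riesz_kernel s x (w k))"
    using sum.reindex[OF inj, of "riesz_kernel s x"] by simp
  also have "\<dots> = (\<Sum>k<M. ereal (kernel_profile s (2 * sin (\<beta> / (2 * real M) + pi * real k / real M))))"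
  proof (intro sum.cong refl)
    fix k assume "k \<in> {..<M}"
    hence "k < M" by simp
    thus "riesz_kernel s x (w k) = ereal (kernel_profile s (2 * sin (\<beta> / (2 * real M) + pi * real k / real M)))"
      using dpos[OF \<open>k < M\<close>] d[OF \<open>k < M\<close>] by (auto simp: riesz_kernel_eq)
  qed
  finally show ?thesis by (simp add: polygon_potential_def)
qed

lemma unit_complex_rotation:
  assumes "norm c = 1" "norm z = 1" "z \<noteq> c"
  obtains \<beta> where "\<beta> \<in> {0<..<2 * pi}" "z = c * cis \<beta>"
proof -
  have n: "norm (z / c) = 1" using assms by (simp add: norm_divide)
  define \<beta> where "\<beta> = Arg2pi (z / c)"
  have "z / c = cis \<beta>" using n Arg2pi_eq[of "z / c"] by (simp add: \<beta>_def cis_conv_exp)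
  moreover have "c \<noteq> 0" using assms by auto
  ultimately have z: "z = c * cis \<beta>" by (simp add: nonzero_divide_eq_eq mult.commute)
  moreover have "\<beta> \<noteq> 0" using z assms by auto
  moreover have "0 \<le> \<beta>" "\<beta> < 2 * pi" unfolding \<beta>_def by (auto simp: Arg2pi)
  ultimately show ?thesis by (intro that[of \<beta>]) auto
qed

lemma sum_polygon_mem:
  assumes "M > 0" "norm c = 1" "x ^ M = c"
  shows "(\<Sum>w\<in>polygon M c. riesz_kernel s x w) = \<infinity>"
proof -
  have "x \<in> polygon M c" using assms by (simp add: polygon_def)
  thus ?thesis using assms
    by (auto simp: sum_Pinfty finite_polygon riesz_kernel_eq intro!: bexI[of _ x])
qed

lemma sum_polygon_midpoint:
  assumes "M > 0" "norm c = 1" "x ^ M = - c"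
  shows "(\<Sum>w\<in>polygon M c. riesz_kernel s x w) = ereal (midpoint_potential s M)"
proof -
  have "norm x = 1" by (rule norm_eq_1_if_power[of _ M]) (use assms in auto)
  moreover have "x ^ M = c * cis pi" using assms by simp
  ultimately show ?thesis
    using sum_polygon_eq[of M c x pi s] assms pi_gt_zero by (simp add: polygon_potential_midpoint)
qed

lemma sum_polygon_greater:
  assumes "s \<ge> 0" "M > 0" "norm c = 1" "norm x = 1" "x ^ M \<noteq> - c"
  shows "(\<Sum>w\<in>polygon M c. riesz_kernel s x w) > ereal (midpoint_potential s M)"
proof (cases "x ^ M = c")
  case True
  thus ?thesis using assms by (simp add: sum_polygon_mem)
next
  case False
  obtain \<beta> where \<beta>: "\<beta> \<in> {0<..<2 * pi}" "x ^ M = c * cis \<beta>"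
    using unit_complex_rotation[of c "x ^ M"] assms False by (auto simp: norm_power)
  have "\<beta> \<noteq> pi" using \<beta> assms by auto
  hence "polygon_potential s M (\<beta> / (2 * real M)) > midpoint_potential s M"
    using \<beta> assms by (intro polygon_potential_greater) (auto simp: field_simps)
  thus ?thesis using sum_polygon_eq[of M c x \<beta> s] \<beta> assms by simp
qed

section \<open>The structure of greedy sequences\<close>

text \<open>
  The greedy condition for the first \<open>L\<close> points only. Blocks of a greedy sequence are greedy
  sequences in their own right, but only as long as they do not outgrow the preceding block, so the
  induction has to be about finite sequences.
\<close>

definition greedy_upto :: "real \<Rightarrow> (nat \<Rightarrow> complex) \<Rightarrow> nat \<Rightarrow> bool" where
  "greedy_upto s a L \<longleftrightarrow> (\<forall>n<L. a n \<in> unit_circle \<and>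
     (\<forall>x\<in>unit_circle. potential s a n (a n) \<le> potential s a n x))"

lemma potential_0 [simp]: "potential s a 0 x = 0"
  by (simp add: potential_def)

lemma greedy_uptoI:
  assumes "greedy_energy_sequence s a"
  shows "greedy_upto s a L"
  unfolding greedy_upto_def
proof (intro allI impI)
  fix n assume "n < L"
  show "a n \<in> unit_circle \<and> (\<forall>x\<in>unit_circle. potential s a n (a n) \<le> potential s a n x)"
    using assms by (cases "n = 0") (auto simp: greedy_energy_sequence_def)
qed

lemma greedy_upto_mono: "greedy_upto s a L \<Longrightarrow> K \<le> L \<Longrightarrow> greedy_upto s a K"
  by (auto simp: greedy_upto_def)

lemma potential_add:
  "potential s a (m + n) x = potential s a m x + potential s (\<lambda>k. a (m + k)) n x"
  by (induction n) (simp_all add: potential_def add.assoc)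

lemma potential_neq_MInf [simp]: "potential s a n x \<noteq> -\<infinity>"
  unfolding potential_def by (induction n) (auto simp: ereal_plus_eq_MInfty)

lemma potential_eq_PInf_iff: "potential s a n x = \<infinity> \<longleftrightarrow> x \<in> a ` {..<n}"
  unfolding potential_def by (auto simp: sum_Pinfty riesz_kernel_eq split: if_splits)

lemma infinite_unit_circle: "infinite unit_circle"
proof
  assume fin: "finite unit_circle"
  define M where "M = Suc (card unit_circle)"
  have "polygon M 1 \<subseteq> unit_circle"
    using polygon_subset_circle[of M 1] by (auto simp: M_def)
  hence "card (polygon M 1) \<le> card unit_circle" using fin by (rule card_mono[rotated])
  thus False using card_polygon[of M 1] by (simp add: M_def)
qed

lemma minimizer_potential_finite:
  assumes "\<And>x. x \<in> unit_circle \<Longrightarrow> potential s a n y \<le> potential s a n x"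
  shows "\<bar>potential s a n y\<bar> \<noteq> \<infinity>"
proof -
  have "infinite (unit_circle - a ` {..<n})" using infinite_unit_circle by simp
  then obtain x where "x \<in> unit_circle" "x \<notin> a ` {..<n}" by (metis Diff_iff ex_in_conv finite.emptyI)
  hence "potential s a n y \<noteq> \<infinity>"
    using assms[of x] potential_eq_PInf_iff[of s a n x] by auto
  thus ?thesis by auto
qed

lemma greedy_inj:
  assumes "greedy_upto s a L"
  shows "inj_on a {..<L}"
proof -
  have "a j \<noteq> a k" if "j < k" "k < L" for j k
  proof -
    have "\<bar>potential s a k (a k)\<bar> \<noteq> \<infinity>"
      by (rule minimizer_potential_finite) (use assms that in \<open>auto simp: greedy_upto_def\<close>)
    hence "a k \<notin> a ` {..<k}" using potential_eq_PInf_iff[of s a k "a k"] by auto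
    thus ?thesis using that(1) by (metis imageI lessThan_iff)
  qed
  thus ?thesis by (metis (mono_tags, lifting) inj_onI lessThan_iff linorder_neqE_nat)
qed

text \<open>
  The induction hypothesis for the structure theorem: the first \<open>2 ^ n\<close> points of every greedy
  sequence lie on a common regular \<open>2 ^ n\<close>-gon, and as long as this polygon is not used up, some
  minimizer of the potential lies on it. For \<open>L = 0\<close> the polygon is not yet determined by the
  sequence and the second statement is made for all polygons; this is what allows the first point
  of a new block to be treated like the others.
\<close>

definition dyadic_structure :: "real \<Rightarrow> nat \<Rightarrow> bool" where
  "dyadic_structure s n \<longleftrightarrow> (\<forall>a L. greedy_upto s a L \<longrightarrow> L \<le> 2 ^ n \<longrightarrow>
     (\<forall>k<L. a k ^ 2 ^ n = a 0 ^ 2 ^ n) \<and>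
     (L < 2 ^ n \<longrightarrow> (\<forall>d. norm d = 1 \<longrightarrow> (L > 0 \<longrightarrow> d = a 0 ^ 2 ^ n) \<longrightarrow>
        (\<exists>y. y ^ 2 ^ n = d \<and> (\<forall>x\<in>unit_circle. potential s a L y \<le> potential s a L x)))))"

lemma dyadic_structure_power:
  assumes "dyadic_structure s n" "greedy_upto s a L" "L \<le> 2 ^ n" "k < L"
  shows "a k ^ 2 ^ n = a 0 ^ 2 ^ n"
  using assms unfolding dyadic_structure_def by blast

lemma dyadic_structure_minimizer:
  assumes "dyadic_structure s n" "greedy_upto s a L" "L < 2 ^ n" "norm d = 1" "L > 0 \<longrightarrow> d = a 0 ^ 2 ^ n"
  obtains y where "y ^ 2 ^ n = d" "\<And>x. x \<in> unit_circle \<Longrightarrow> potential s a L y \<le> potential s a L x"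
proof -
  have "\<exists>y. y ^ 2 ^ n = d \<and> (\<forall>x\<in>unit_circle. potential s a L y \<le> potential s a L x)"
    using assms(1)[unfolded dyadic_structure_def, THEN spec, THEN spec, THEN mp, OF assms(2),
        THEN mp, OF less_imp_le[OF assms(3)], THEN conjunct2, THEN mp, OF assms(3),
        THEN spec, THEN mp, OF assms(4), THEN mp, OF assms(5)] .
  thus ?thesis using that by blast
qed

lemma ex_unit_root:
  assumes "norm d = 1" "M > 0"
  obtains y where "y \<in> unit_circle" "y ^ M = (d::complex)"
proof -
  have "polygon M d \<noteq> {}" using card_polygon[OF assms(2,1)] assms(2) by auto
  then obtain y where "y \<in> polygon M d" by auto
  thus ?thesis using that polygon_subset_circle[OF assms(2,1)] by (auto simp: polygon_def)
qed

lemma greedy_first_block: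
  assumes D: "dyadic_structure s n" and g: "greedy_upto s a (2 ^ n)"
  shows "potential s a (2 ^ n) x = (\<Sum>w\<in>polygon (2 ^ n) (a 0 ^ 2 ^ n). riesz_kernel s x w)"
proof -
  have c: "norm (a 0 ^ 2 ^ n) = 1"
    using g by (simp add: greedy_upto_def norm_power)
  have inj: "inj_on a {..<2 ^ n}" by (rule greedy_inj[OF g])
  have "\<forall>k<2 ^ n. a k ^ 2 ^ n = a 0 ^ 2 ^ n"
    using dyadic_structure_power[OF D g] by blast
  hence "a ` {..<2 ^ n} \<subseteq> polygon (2 ^ n) (a 0 ^ 2 ^ n)"
    unfolding polygon_def by blast
  hence "a ` {..<2 ^ n} = polygon (2 ^ n) (a 0 ^ 2 ^ n)"
    by (rule card_subset_eq[rotated]) (simp_all only: card_polygon card_image[OF inj] finite_polygon c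
          card_lessThan zero_less_power pos2)
  thus ?thesis
    unfolding potential_def using sum.reindex[OF inj, of "riesz_kernel s x"] by simp
qed

text \<open>
  After \<open>2 ^ n\<close> points the potential is that of a complete polygon plus that of the later points.
  The former is minimal exactly at the arc midpoints, and by induction one of these midpoints also
  minimizes the latter. Hence the minimum of the sum is the sum of the minima, each new point
  minimizes both summands, so it is an arc midpoint, and the new block is greedy by itself.
\<close>

lemma greedy_second_block:
  assumes s: "s \<ge> 0" and D: "dyadic_structure s n" and g: "greedy_upto s a (2 ^ n + j)"
    and j: "j \<le> 2 ^ n"
  shows "greedy_upto s (\<lambda>k. a (2 ^ n + k)) j \<and> (\<forall>k<j. a (2 ^ n + k) ^ 2 ^ n = - (a 0 ^ 2 ^ n))"
  using g j
proof (induction j)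
  case (Suc j)
  define b where "b = (\<lambda>k. a (2 ^ n + k))"
  define A where "A = (\<lambda>x. \<Sum>w\<in>polygon (2 ^ n) (a 0 ^ 2 ^ n). riesz_kernel s x w)"
  define V where "V = potential s b j"
  define m where "m = midpoint_potential s (2 ^ n)"
  have c: "norm (a 0 ^ 2 ^ n) = 1"
    using Suc.prems by (auto simp: greedy_upto_def norm_power)
  have IH: "greedy_upto s b j" "\<And>k. k < j \<Longrightarrow> b k ^ 2 ^ n = - (a 0 ^ 2 ^ n)"
    using Suc greedy_upto_mono[OF Suc.prems(1), of "2 ^ n + j"] by (auto simp: b_def)
  have pot: "potential s a (2 ^ n + j) x = A x + V x" for x
    using greedy_first_block[OF D greedy_upto_mono[OF Suc.prems(1)], of x]
    by (simp add: potential_add A_def V_def b_def)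
  have bj: "b j \<in> unit_circle" "\<And>x. x \<in> unit_circle \<Longrightarrow> A (b j) + V (b j) \<le> A x + V x"
    using Suc.prems(1) by (auto simp: greedy_upto_def b_def pot[symmetric])
  obtain y where y: "y ^ 2 ^ n = - (a 0 ^ 2 ^ n)" "\<And>x. x \<in> unit_circle \<Longrightarrow> V y \<le> V x"
  proof -
    have "norm (- (a 0 ^ 2 ^ n)) = 1" using c by simp
    moreover have "j > 0 \<longrightarrow> - (a 0 ^ 2 ^ n) = b 0 ^ 2 ^ n" using IH(2)[of 0] by auto
    ultimately show ?thesis
      using dyadic_structure_minimizer[OF D IH(1)] Suc.prems(2) that unfolding V_def
      by (metis Suc_le_lessD)
  qed
  have yc: "y \<in> unit_circle" using norm_eq_1_if_power[of y "2 ^ n"] y(1) c by simp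
  have Ay: "A y = ereal m" unfolding A_def m_def by (rule sum_polygon_midpoint) (use y c in auto)
  have Vy: "\<bar>V y\<bar> \<noteq> \<infinity>" unfolding V_def
    by (rule minimizer_potential_finite) (use y in \<open>auto simp: V_def\<close>)
  then obtain v where v: "V y = ereal v" by auto
  have le: "A (b j) + V (b j) \<le> ereal (m + v)" using bj(2)[OF yc] Ay v by simp
  have Vb: "ereal v \<le> V (b j)" using y(2)[OF bj(1)] v by simp
  have 1: "b j ^ 2 ^ n = - (a 0 ^ 2 ^ n)"
  proof (rule ccontr)
    assume "b j ^ 2 ^ n \<noteq> - (a 0 ^ 2 ^ n)"
    hence "A (b j) > ereal m"
      unfolding A_def m_def using bj(1) s c by (intro sum_polygon_greater) auto
    thus False using le Vb by (cases "A (b j)"; cases "V (b j)") auto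
  qed
  hence "A (b j) = ereal m" unfolding A_def m_def by (intro sum_polygon_midpoint) (use c in auto)
  hence "V (b j) \<le> ereal v" using le by (cases "V (b j)") auto
  hence "V (b j) \<le> V x" if "x \<in> unit_circle" for x using y(2)[OF that] v by auto
  hence "greedy_upto s b (Suc j)"
    using IH(1) bj(1) by (auto simp: greedy_upto_def V_def less_Suc_eq)
  thus ?case using 1 IH(2) by (auto simp: b_def less_Suc_eq)
qed (simp add: greedy_upto_def)

text \<open>
  By \<open>greedy_second_block\<close> the points of the two blocks satisfy \<open>x ^ (2 ^ n) = d\<close> and
  \<open>x ^ (2 ^ n) = - d\<close> for the same \<open>d\<close>, so all of them share the power with exponent \<open>2 ^ (n + 1)\<close>.
  A minimizer on the larger polygon comes from one of the smaller polygons: from the one of the first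
  block while that block is incomplete, and from the one formed by its arc midpoints afterwards.
\<close>

lemma dyadic_structure_all:
  assumes "s \<ge> 0"
  shows "dyadic_structure s n"
proof (induction n)
  case 0
  show ?case unfolding dyadic_structure_def
    by (auto simp: le_Suc_eq)
next
  case (Suc n)
  note D = this
  show ?case unfolding dyadic_structure_def
  proof (intro allI impI conjI)
    fix a L k assume g: "greedy_upto s a L" and L: "L \<le> 2 ^ Suc n" and k: "k < L"
    have sq: "z ^ 2 ^ Suc n = (z ^ 2 ^ n) ^ 2" for z :: complex
      by (simp add: mult.commute flip: power_mult)
    show "a k ^ 2 ^ Suc n = a 0 ^ 2 ^ Suc n"
    proof (cases "k < 2 ^ n")
      case True
      have "a k ^ 2 ^ n = a 0 ^ 2 ^ n"
        by (rule dyadic_structure_power[OF D greedy_upto_mono[OF g, of "min L (2 ^ n)"]]) (use k True in auto)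
      thus ?thesis by (simp only: sq)
    next
      case False
      define j where "j = L - 2 ^ n"
      have "L = 2 ^ n + j" "j \<le> 2 ^ n" using False k L by (auto simp: j_def)
      hence "a (2 ^ n + (k - 2 ^ n)) ^ 2 ^ n = - (a 0 ^ 2 ^ n)"
        using greedy_second_block[OF assms D, of a j, THEN conjunct2, rule_format, of "k - 2 ^ n"] g False k
        by simp
      thus ?thesis using False by (simp only: sq) simp
    qed
  next
    fix a L d
    assume g: "greedy_upto s a L" and L: "L < 2 ^ Suc n" and d: "norm d = 1" "0 < L \<longrightarrow> d = a 0 ^ 2 ^ Suc n"
    have sq: "z ^ 2 ^ Suc n = (z ^ 2 ^ n) ^ 2" for z :: complex
      by (simp add: mult.commute flip: power_mult)
    show "\<exists>y. y ^ 2 ^ Suc n = d \<and> (\<forall>x\<in>unit_circle. potential s a L y \<le> potential s a L x)"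
    proof (cases "L < 2 ^ n")
      case True
      obtain d' where d': "norm d' = 1" "d' ^ 2 = d" "0 < L \<longrightarrow> d' = a 0 ^ 2 ^ n"
      proof (cases "L = 0")
        case True
        thus ?thesis using ex_unit_root[of d 2] d that by auto
      next
        case False
        thus ?thesis using that[of "a 0 ^ 2 ^ n"] d g sq[of "a 0"]
          by (auto simp: greedy_upto_def norm_power)
      qed
      obtain y where "y ^ 2 ^ n = d'" "\<And>x. x \<in> unit_circle \<Longrightarrow> potential s a L y \<le> potential s a L x"
        using dyadic_structure_minimizer[OF D g True d'(1,3)] by blast
      thus ?thesis using d' by (intro exI[of _ y]) (simp add: sq del: power_Suc)
    next
      case False
      define j where "j = L - 2 ^ n"
      have j: "L = 2 ^ n + j" "j < 2 ^ n" using False L by (auto simp: j_def)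
      define b where "b = (\<lambda>k. a (2 ^ n + k))"
      have c: "norm (a 0 ^ 2 ^ n) = 1" using g j by (auto simp: greedy_upto_def norm_power)
      have b: "greedy_upto s b j" "\<And>k. k < j \<Longrightarrow> b k ^ 2 ^ n = - (a 0 ^ 2 ^ n)"
        using greedy_second_block[OF assms D, of a j] g j by (auto simp: b_def)
      have "norm (- (a 0 ^ 2 ^ n)) = 1" "j > 0 \<longrightarrow> - (a 0 ^ 2 ^ n) = b 0 ^ 2 ^ n"
        using c b(2)[of 0] by auto
      from dyadic_structure_minimizer[OF D b(1) j(2) this]
      obtain y where y: "y ^ 2 ^ n = - (a 0 ^ 2 ^ n)"
          "\<And>x. x \<in> unit_circle \<Longrightarrow> potential s b j y \<le> potential s b j x" by blast
      have pot: "potential s a L x =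
          (\<Sum>w\<in>polygon (2 ^ n) (a 0 ^ 2 ^ n). riesz_kernel s x w) + potential s b j x" for x
        using greedy_first_block[OF D greedy_upto_mono[OF g], of x] j
        by (simp add: potential_add b_def)
      have "potential s a L y \<le> potential s a L x" if "x \<in> unit_circle" for x
        unfolding pot
      proof (rule add_mono)
        have "(\<Sum>w\<in>polygon (2 ^ n) (a 0 ^ 2 ^ n). riesz_kernel s y w) = ereal (midpoint_potential s (2 ^ n))"
          by (rule sum_polygon_midpoint) (use y c in auto)
        also have "\<dots> \<le> (\<Sum>w\<in>polygon (2 ^ n) (a 0 ^ 2 ^ n). riesz_kernel s x w)"
          using sum_polygon_greater[of s "2 ^ n" "a 0 ^ 2 ^ n" x]
            sum_polygon_midpoint[of "2 ^ n" "a 0 ^ 2 ^ n" x s] c assms that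
          by (cases "x ^ 2 ^ n = - (a 0 ^ 2 ^ n)") (auto intro: less_imp_le)
        finally show "(\<Sum>w\<in>polygon (2 ^ n) (a 0 ^ 2 ^ n). riesz_kernel s y w)
          \<le> (\<Sum>w\<in>polygon (2 ^ n) (a 0 ^ 2 ^ n). riesz_kernel s x w)" .
      qed (use y that in auto)
      moreover have "y ^ 2 ^ Suc n = d" using y(1) d j by (simp only: sq) auto
      ultimately show ?thesis by blast
    qed
  qed
qed

text \<open>
  The leading binary digit \<open>2 ^ n\<close> of \<open>N\<close> accounts for the first block, a full polygon seen from an arc
  midpoint. The remaining points are a greedy sequence, to which the lower digits belong.
\<close>

lemma greedy_upto_potential:
  assumes "s \<ge> 0" "greedy_upto s a (Suc N)"
  shows "potential s a N (a N) = ereal (binsum (\<lambda>n. midpoint_potential s (2 ^ n)) N)"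
  using assms(2)
proof (induction N arbitrary: a rule: binary_induct)
  case (add n j)
  define b where "b = (\<lambda>k. a (2 ^ n + k))"
  note D = dyadic_structure_all[OF assms(1), of n]
  have c: "norm (a 0 ^ 2 ^ n) = 1" using add.prems by (auto simp: greedy_upto_def norm_power)
  have b: "greedy_upto s b (Suc j)" "b j ^ 2 ^ n = - (a 0 ^ 2 ^ n)"
    using greedy_second_block[OF assms(1) D, of a "Suc j"] add.prems add.hyps by (auto simp: b_def)
  have "potential s a (2 ^ n + j) (b j) =
     (\<Sum>w\<in>polygon (2 ^ n) (a 0 ^ 2 ^ n). riesz_kernel s (b j) w) + potential s b j (b j)"
    using greedy_first_block[OF D greedy_upto_mono[OF add.prems], of "b j"]
    by (simp add: potential_add b_def)
  also have "(\<Sum>w\<in>polygon (2 ^ n) (a 0 ^ 2 ^ n). riesz_kernel s (b j) w) = ereal (midpoint_potential s (2 ^ n))"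
    by (rule sum_polygon_midpoint) (use b c in auto)
  also have "potential s b j (b j) = ereal (binsum (\<lambda>n. midpoint_potential s (2 ^ n)) j)"
    by (rule add.IH[OF b(1)])
  finally show ?case using add.hyps by (simp add: b_def binsum_exp_add)
qed (simp add: zero_ereal_def)

definition greedy_value :: "real \<Rightarrow> nat \<Rightarrow> real" where
  "greedy_value s = binsum (\<lambda>n. midpoint_potential s (2 ^ n))"

lemma greedy_potential:
  assumes "s \<ge> 0" "greedy_energy_sequence s a"
  shows "potential s a N (a N) = ereal (greedy_value s N)"
  using greedy_upto_potential[OF assms(1) greedy_uptoI[OF assms(2)]] by (simp add: greedy_value_def)

text \<open>
  The greedy choice gives \<open>U N (a N) \<le> U N (a (N + 1))\<close>, and the additional term in \<open>U (N + 1) (a (N + 1))\<close>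
  is at least the value of the kernel at the diameter. This bound on the steps in one direction
  later yields the intermediate values.
\<close>

lemma greedy_value_Suc_ge:
  assumes "s \<ge> 0" "greedy_energy_sequence s a"
  shows "greedy_value s (Suc N) \<ge> greedy_value s N + kernel_profile s 2"
proof -
  have circ: "a n \<in> unit_circle" for n using assms(2) by (auto simp: greedy_energy_sequence_def)
  define d where "d = dist (a (Suc N)) (a N)"
  have d: "0 < d" "d \<le> 2"
  proof -
    have "inj_on a {..<Suc (Suc N)}" by (rule greedy_inj[OF greedy_uptoI[OF assms(2)]])
    hence "a (Suc N) \<noteq> a N" by (metis inj_on_def lessThan_iff lessI less_SucI n_not_Suc_n)
    thus "0 < d" by (simp add: d_def)
    have "d \<le> norm (a (Suc N)) + norm (a N)" unfolding d_def dist_norm by (rule norm_triangle_ineq4)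
    thus "d \<le> 2" using circ[of N] circ[of "Suc N"] by simp
  qed
  have "kernel_profile s 2 \<le> kernel_profile s d"
    using d assms(1) by (auto simp: kernel_profile_def intro: powr_mono2')
  hence "ereal (greedy_value s N + kernel_profile s 2) \<le> ereal (greedy_value s N) + ereal (kernel_profile s d)"
    by simp
  also have "ereal (greedy_value s N) = potential s a N (a N)" by (rule greedy_potential[OF assms, symmetric])
  also have "\<dots> \<le> potential s a N (a (Suc N))"
    using greedy_uptoI[OF assms(2), of "Suc N"] circ[of "Suc N"] by (auto simp: greedy_upto_def)
  also have "potential s a N (a (Suc N)) + ereal (kernel_profile s d) = potential s a (Suc N) (a (Suc N))"
    using d by (simp add: potential_def riesz_kernel_eq d_def)
  also have "\<dots> = ereal (greedy_value s (Suc N))" by (rule greedy_potential[OF assms])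
  finally show ?thesis by (simp add: add_right_mono)
qed

section \<open>The zeta function as a limit of partial sums\<close>

definition zeta_partial :: "real \<Rightarrow> nat \<Rightarrow> real" where
  "zeta_partial s N = (\<Sum>k<N. real (Suc k) powr (-s))"

lemma sum_zeta_term:
  assumes "s \<noteq> 1"
  shows "(\<Sum>n<N. zeta_term n s) = (\<Sum>n<N. of_nat (Suc n) powr (-s)) - (of_nat (Suc N) powr (1 - s) - 1) / (1 - s)"
proof (induction N)
  case (Suc N)
  thus ?case using assms by (simp add: zeta_term_def diff_divide_distrib algebra_simps)
qed simp

lemma zeta_term_suminf_holomorphic:
  "(\<lambda>s. \<Sum>n. zeta_term n s) holomorphic_on zeta_domain"
proof (rule holomorphic_uniform_sequence[OF open_zeta_domain])
  show "(\<lambda>s. \<Sum>i<n. zeta_term i s) holomorphic_on zeta_domain" for n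
    unfolding zeta_term_def by (intro holomorphic_intros) (auto simp: zeta_domain_def)
next
  fix z assume z: "z \<in> zeta_domain"
  obtain e where e: "e > 0" "cball z e \<subseteq> zeta_domain"
    using z open_zeta_domain open_contains_cball by blast
  define d where "d = min e (Re z / 2)"
  have d: "d > 0" "cball z d \<subseteq> zeta_domain" using z e by (auto simp: d_def zeta_domain_def)
  have "uniform_limit (cball z d) (\<lambda>n s. \<Sum>i<n. zeta_term i s) (\<lambda>s. \<Sum>n. zeta_term n s) sequentially"
  proof (rule Weierstrass_m_test)
    fix n s assume s: "s \<in> cball z d"
    hence nd: "norm (s - z) \<le> d" by (simp add: dist_norm norm_minus_commute)
    have re: "Re s \<ge> Re z / 2" using abs_Re_le_cmod[of "s - z"] nd by (auto simp: d_def abs_le_iff)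
    have no: "norm s \<le> norm z + d" using norm_triangle_ineq[of "s - z" z] nd by simp
    have "norm (zeta_term n s) \<le> norm s * real (Suc n) powr (- Re s - 1)"
      using s d by (intro norm_zeta_term_le) auto
    also have "\<dots> \<le> (norm z + d) * real (Suc n) powr (- (Re z / 2) - 1)"
      using re no d(1) by (intro mult_mono powr_mono) auto
    finally show "norm (zeta_term n s) \<le> (norm z + d) * real (Suc n) powr (- (Re z / 2) - 1)" .
  next
    show "summable (\<lambda>n. (norm z + d) * real (Suc n) powr (- (Re z / 2) - 1))"
      using z by (intro summable_mult summable_Suc_powr) (auto simp: zeta_domain_def)
  qed
  with d show "\<exists>d>0. cball z d \<subseteq> zeta_domain \<and>
      uniform_limit (cball z d) (\<lambda>n s. \<Sum>i<n. zeta_term i s) (\<lambda>s. \<Sum>n. zeta_term n s) sequentially"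
    by blast
qed

lemma zeta_term_sums_suminf:
  assumes "s \<in> zeta_domain"
  shows "(\<lambda>n. zeta_term n s) sums (\<Sum>n. zeta_term n s)"
proof -
  have "summable (\<lambda>n. norm s * real (Suc n) powr (- Re s - 1))"
    using assms by (intro summable_mult summable_Suc_powr) (auto simp: zeta_domain_def)
  hence "summable (\<lambda>n. zeta_term n s)"
    by (rule summable_comparison_test') (use norm_zeta_term_le[OF assms] in auto)
  thus ?thesis by (rule summable_sums)
qed

lemma tendsto_powr_zeta:
  assumes "1 < Re s"
  shows "(\<lambda>n. complex_of_nat (Suc n) powr (1 - s)) \<longlonglongrightarrow> 0"
proof -
  have "(\<lambda>n. real (Suc n) powr (1 - Re s)) \<longlonglongrightarrow> 0"
    using assms by real_asymp
  hence "(\<lambda>n. norm (complex_of_nat (Suc n) powr (1 - s))) \<longlonglongrightarrow> 0"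
    by (simp add: norm_powr_real_powr del: of_nat_Suc)
  thus ?thesis by (rule tendsto_norm_zero_cancel)
qed

text \<open>
  The series of the terms \<open>n powr (-s)\<close> minus their integrals converges on all of
  \<open>zeta_domain\<close> and telescopes against the Dirichlet series of the zeta function where the latter
  converges; the identity theorem does the rest.
\<close>

lemma zeta_term_sums:
  assumes "s \<in> zeta_domain"
  shows "(\<lambda>n. zeta_term n s) sums (riemann_zeta s - 1 / (s - 1))"
proof -
  define f where "f = (\<lambda>s. (\<Sum>n. zeta_term n s) + 1 / (s - 1))"
  have "is_zeta f" unfolding is_zeta_def
  proof (intro conjI allI impI)
    show "f holomorphic_on zeta_domain" unfolding f_def
      by (intro holomorphic_intros zeta_term_suminf_holomorphic) (auto simp: zeta_domain_def)
  next
    fix s :: complex assume s: "1 < Re s"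
    hence dom: "s \<in> zeta_domain" and s1: "s \<noteq> 1" by (auto simp: zeta_domain_def)
    have "(\<lambda>N. (\<Sum>n<N. zeta_term n s) + (of_nat (Suc N) powr (1 - s) - 1) / (1 - s)) \<longlonglongrightarrow>
            (\<Sum>n. zeta_term n s) + (0 - 1) / (1 - s)"
      using zeta_term_sums_suminf[OF dom] s1
      by (intro tendsto_intros tendsto_powr_zeta s) (simp_all add: sums_def)
    also have "(0 - 1) / (1 - s) = 1 / (s - 1)" using s1 by (simp add: divide_simps)
    finally show "(\<lambda>n. of_nat (Suc n) powr (-s)) sums f s"
      by (simp add: sum_zeta_term[OF s1] sums_def f_def)
  qed
  hence "riemann_zeta s = f s" by (rule is_zeta_unique[OF is_zeta_riemann_zeta _ assms])
  thus ?thesis using zeta_term_sums_suminf[OF assms] by (simp add: f_def)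
qed

text \<open>
  For \<open>s > 1\<close> the subtracted term tends to zero, for \<open>s < 1\<close> it removes the divergent part of the
  partial sums.
\<close>

lemma zeta_partial_limit:
  assumes "s > 0" "s \<noteq> 1"
  shows "(\<lambda>N. zeta_partial s N - real N powr (1 - s) / (1 - s)) \<longlonglongrightarrow> Re (riemann_zeta (of_real s))"
proof -
  define z where "z = complex_of_real s"
  have z: "z \<in> zeta_domain" "z \<noteq> 1" using assms by (auto simp: z_def zeta_domain_def)
  have pw: "complex_of_nat (Suc n) powr of_real r = of_real (real (Suc n) powr r)" for n r
    by (subst powr_of_real[symmetric]) auto
  have eq: "(\<Sum>n<N. zeta_term n z) = of_real (zeta_partial s N - (real (Suc N) powr (1 - s) - 1) / (1 - s))" for N
    unfolding z_def sum_zeta_term[OF z(2)[unfolded z_def]] zeta_partial_def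
    using pw[of _ "-s"] pw[of N "1 - s"] by (simp del: of_nat_Suc)
  have "(\<lambda>N. Re (\<Sum>n<N. zeta_term n z)) \<longlonglongrightarrow> Re (riemann_zeta z - 1 / (z - 1))"
    using zeta_term_sums[OF z(1)] unfolding sums_def by (intro tendsto_intros)
  moreover have "Re (1 / (z - 1)) = 1 / (s - 1)" by (simp add: z_def Re_divide power2_eq_square)
  ultimately have 1: "(\<lambda>N. zeta_partial s N - (real (Suc N) powr (1 - s) - 1) / (1 - s))
      \<longlonglongrightarrow> Re (riemann_zeta z) - 1 / (s - 1)"
    by (simp only: eq Re_complex_of_real minus_complex.simps)
  have 2: "(\<lambda>N. real (Suc N) powr (-s)) \<longlonglongrightarrow> 0"
    using assms by real_asymp
  have "(\<lambda>N. (zeta_partial s N - (real (Suc N) powr (1 - s) - 1) / (1 - s))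
        + real (Suc N) powr (-s) + 1 / (s - 1))
      \<longlonglongrightarrow> (Re (riemann_zeta z) - 1 / (s - 1)) + 0 + 1 / (s - 1)"
    by (intro tendsto_add 1 2 tendsto_const)
  moreover have "1 / (s - 1) = - (1 / (1 - s))" using assms by (simp add: divide_simps)
  ultimately have "(\<lambda>N. zeta_partial s (Suc N) - real (Suc N) powr (1 - s) / (1 - s))
      \<longlonglongrightarrow> Re (riemann_zeta z)"
    by (simp add: diff_divide_distrib zeta_partial_def algebra_simps)
  thus ?thesis unfolding z_def by (rule LIMSEQ_imp_Suc)
qed

lemma powr_Suc_le_diff:
  assumes "0 < s" "s < 1" "n > 0"
  shows "real (Suc n) powr (-s) \<le> (real (Suc n) powr (1 - s) - real n powr (1 - s)) / (1 - s)"
proof -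
  have "\<exists>z>real n. z < real (Suc n) \<and>
      real (Suc n) powr (1 - s) - real n powr (1 - s) = (real (Suc n) - real n) * ((1 - s) * z powr (1 - s - 1))"
    by (rule MVT2) (use assms in \<open>auto intro!: derivative_eq_intros\<close>)
  then obtain z where z: "real n < z" "z < real (Suc n)"
    "real (Suc n) powr (1 - s) - real n powr (1 - s) = (1 - s) * z powr (-s)" by auto
  have "real (Suc n) powr (-s) \<le> z powr (-s)" using z assms by (intro powr_mono2') auto
  thus ?thesis using z(3) assms by simp
qed

text \<open>
  Comparison of the partial sums with the integral of \<open>x powr (-s)\<close> from \<open>1\<close> to \<open>N\<close>.
\<close>

lemma riemann_zeta_nonpos:
  assumes "0 < s" "s < 1"
  shows "Re (riemann_zeta (of_real s)) \<le> 0"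
proof -
  have "zeta_partial s (Suc N) - real (Suc N) powr (1 - s) / (1 - s) \<le> 1 - 1 / (1 - s)" for N
  proof (induction N)
    case (Suc N)
    thus ?case using powr_Suc_le_diff[of s "Suc N"] assms
      by (simp add: zeta_partial_def diff_divide_distrib)
  qed (simp add: zeta_partial_def)
  moreover have "1 - 1 / (1 - s) \<le> 0" using assms by (simp add: field_simps)
  ultimately have "zeta_partial s (Suc N) - real (Suc N) powr (1 - s) / (1 - s) \<le> 0" for N
    by (meson order_trans)
  thus ?thesis using assms by (intro LIMSEQ_le_const2[OF LIMSEQ_Suc[OF zeta_partial_limit]]) auto
qed

lemma riemann_zeta_nonneg:
  assumes "s > 1"
  shows "Re (riemann_zeta (of_real s)) \<ge> 0"
proof (rule LIMSEQ_le_const)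
  show "(\<lambda>N. zeta_partial s N - real N powr (1 - s) / (1 - s)) \<longlonglongrightarrow> Re (riemann_zeta (of_real s))"
    using assms by (intro zeta_partial_limit) auto
  have "zeta_partial s N \<ge> 0" "real N powr (1 - s) / (1 - s) \<le> 0" for N
    using assms by (auto simp: zeta_partial_def divide_nonneg_neg intro: sum_nonneg)
  thus "\<exists>N. \<forall>n\<ge>N. 0 \<le> zeta_partial s n - real n powr (1 - s) / (1 - s)"
    by (meson diff_ge_0_iff_ge order_trans)
qed

definition odd_partial :: "real \<Rightarrow> nat \<Rightarrow> real" where
  "odd_partial s m = (\<Sum>k<m. (2 * real k + 1) powr (-s))"

lemma odd_partial_eq: "odd_partial s m = zeta_partial s (2 * m) - 2 powr (-s) * zeta_partial s m"
proof (induction m)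
  case (Suc m)
  have "(2 + 2 * real m) powr (-s) = 2 powr (-s) * (1 + real m) powr (-s)"
    by (subst powr_mult[symmetric]) (auto simp: algebra_simps)
  thus ?case using Suc by (simp add: odd_partial_def zeta_partial_def algebra_simps)
qed (simp add: odd_partial_def zeta_partial_def)

lemma odd_partial_limit:
  assumes "s > 0" "s \<noteq> 1"
  shows "(\<lambda>m. odd_partial s m - 2 powr (-s) * real m powr (1 - s) / (1 - s))
           \<longlonglongrightarrow> (1 - 2 powr (-s)) * Re (riemann_zeta (of_real s))"
proof -
  note Z = zeta_partial_limit[OF assms]
  have "filterlim (\<lambda>m::nat. 2 * m) sequentially sequentially"
    by (rule filterlim_subseq) (auto simp: strict_mono_def)
  note Z2 = filterlim_compose[OF Z this]
  have eq: "(zeta_partial s (2 * m) - real (2 * m) powr (1 - s) / (1 - s)) -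
      2 powr (-s) * (zeta_partial s m - real m powr (1 - s) / (1 - s)) =
      odd_partial s m - 2 powr (-s) * real m powr (1 - s) / (1 - s)" for m
  proof -
    have "real (2 * m) powr (1 - s) = 2 * 2 powr (-s) * real m powr (1 - s)"
      using powr_add[of 2 1 "-s"] by (simp add: powr_mult)
    hence "real (2 * m) powr (1 - s) / (1 - s) = 2 * (2 powr (-s) * real m powr (1 - s) / (1 - s))"
      by simp
    thus ?thesis by (simp only: odd_partial_eq) (simp add: algebra_simps)
  qed
  show ?thesis
    using tendsto_diff[OF Z2 tendsto_mult[OF tendsto_const[of "2 powr (-s)"] Z]]
    unfolding eq by (simp add: algebra_simps)
qed

lemma odd_partial_limit_harmonic:
  "(\<lambda>m. odd_partial 1 m - ln (real m) / 2) \<longlonglongrightarrow> ln 2 + euler_mascheroni / 2"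
proof -
  have zh: "zeta_partial 1 N = harm N" for N
    by (induction N) (simp_all add: zeta_partial_def harm_Suc harm_def powr_minus)
  note H = euler_mascheroni_LIMSEQ
  have "filterlim (\<lambda>m::nat. 2 * m) sequentially sequentially"
    by (rule filterlim_subseq) (auto simp: strict_mono_def)
  note H2 = filterlim_compose[OF H this]
  have "(\<lambda>m. (harm (2 * m) - ln (real (2 * m))) - (harm m - ln (real m)) / 2 + ln 2)
      \<longlonglongrightarrow> euler_mascheroni - euler_mascheroni / 2 + ln 2"
    by (intro tendsto_intros H H2) auto
  moreover have "eventually (\<lambda>m. (harm (2 * m) - ln (real (2 * m))) - (harm m - ln (real m)) / 2 + ln 2 =
      odd_partial 1 m - ln (real m) / 2) sequentially"
    using eventually_gt_at_top[of 0]
  proof eventually_elim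
    case (elim m)
    thus ?case by (simp add: odd_partial_eq zh ln_mult powr_minus field_simps)
  qed
  ultimately show ?thesis by (simp add: tendsto_cong add.commute)
qed

section \<open>Asymptotics of the midpoint potential\<close>

text \<open>
  On each cell both the midpoint value and the mean of \<open>q\<close> lie between the values at the ends of
  the cell, so the errors are dominated by increments of \<open>q\<close>, and these telescope. The
  error stays bounded as the mesh is refined although \<open>q\<close> need not be differentiable at \<open>0\<close>.
\<close>

lemma midpoint_rule_monotone:
  fixes q :: "real \<Rightarrow> real"
  assumes mono: "mono_on {0..b} q" and b: "b > 0" and m: "m > 0"
  shows "\<bar>(\<Sum>k<m. q (b * (2 * real k + 1) / (2 * real m))) - real m / b * integral {0..b} q\<bar> \<le> q b - q 0"
proof -
  define h where "h = b / real m"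
  have h: "h > 0" using b m by (simp add: h_def)
  have hm: "real m * h = b" using m by (simp add: h_def)
  have mid: "b * (2 * real k + 1) / (2 * real m) = (real k + 1/2) * h" for k
    by (simp add: h_def field_simps)
  have int: "q integrable_on {x..y}" if "0 \<le> x" "y \<le> b" for x y
    by (rule integrable_on_mono_on, rule mono_on_subset[OF mono]) (use that in auto)
  have le: "real j * h \<le> b" if "j \<le> m" for j
    using that h unfolding hm[symmetric] by (intro mult_right_mono) auto
  have split: "integral {0..real j * h} q = (\<Sum>k<j. integral {real k * h..real (Suc k) * h} q)" if "j \<le> m" for j
    using that
  proof (induction j)
    case (Suc j)
    have "integral {0..real j * h} q + integral {real j * h..real (Suc j) * h} q = integral {0..real (Suc j) * h} q"
      using h le[OF Suc.prems] by (intro Henstock_Kurzweil_Integration.integral_combine int) auto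
    thus ?case using Suc by simp
  qed simp
  have cell: "\<bar>h * q ((real k + 1/2) * h) - integral {real k * h..real (Suc k) * h} q\<bar>
      \<le> h * (q (real (Suc k) * h) - q (real k * h))" if k: "k < m" for k
  proof -
    have kb: "0 \<le> real k * h" "real (Suc k) * h \<le> b" "real k * h \<le> (real k + 1/2) * h"
        "(real k + 1/2) * h \<le> real (Suc k) * h"
      using le[of "Suc k"] k h by (auto simp: algebra_simps)
    have w: "real (Suc k) * h - real k * h = h" by (simp add: algebra_simps)
    have q1: "q (real k * h) \<le> q x" "q x \<le> q (real (Suc k) * h)"
      if "x \<in> {real k * h..real (Suc k) * h}" for x
      using that kb by (auto intro!: mono_onD[OF mono])
    note i = int[OF kb(1,2)]
    have "h * q (real k * h) \<le> integral {real k * h..real (Suc k) * h} q"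
      using integral_le[OF integrable_const_ivl i, of "q (real k * h)"] q1 w h by simp
    moreover have "integral {real k * h..real (Suc k) * h} q \<le> h * q (real (Suc k) * h)"
      using integral_le[OF i integrable_const_ivl, of "q (real (Suc k) * h)"] q1 w h by simp
    moreover have "h * q (real k * h) \<le> h * q ((real k + 1/2) * h)"
        "h * q ((real k + 1/2) * h) \<le> h * q (real (Suc k) * h)"
      using q1[of "(real k + 1/2) * h"] kb h by (auto intro!: mult_left_mono)
    ultimately show ?thesis by (simp add: right_diff_distrib abs_le_iff)
  qed
  have "\<bar>h * (\<Sum>k<m. q ((real k + 1/2) * h)) - integral {0..b} q\<bar> =
      \<bar>\<Sum>k<m. h * q ((real k + 1/2) * h) - integral {real k * h..real (Suc k) * h} q\<bar>"
    using split[of m] by (simp add: hm sum_distrib_left sum_subtractf)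
  also have "\<dots> \<le> (\<Sum>k<m. h * (q (real (Suc k) * h) - q (real k * h)))"
    by (rule order_trans[OF sum_abs sum_mono]) (use cell in auto)
  also have "\<dots> = h * (q b - q 0)"
    using sum_lessThan_telescope[of "\<lambda>k. q (real k * h)" m] by (simp add: hm flip: sum_distrib_left)
  finally have "\<bar>h * (\<Sum>k<m. q ((real k + 1/2) * h)) - integral {0..b} q\<bar> / h \<le> q b - q 0"
    using h by (simp add: field_simps)
  also have "\<bar>h * (\<Sum>k<m. q ((real k + 1/2) * h)) - integral {0..b} q\<bar> / h =
     \<bar>(h * (\<Sum>k<m. q ((real k + 1/2) * h)) - integral {0..b} q) / h\<bar>" using h by simp
  also have "(h * (\<Sum>k<m. q ((real k + 1/2) * h)) - integral {0..b} q) / h =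
     (\<Sum>k<m. q ((real k + 1/2) * h)) - real m / b * integral {0..b} q"
    using h m b by (simp add: h_def field_simps)
  finally show ?thesis unfolding mid .
qed

text \<open>
  This is \<open>tan (u / 2) \<ge> u / 2\<close> in disguise.
\<close>

lemma sin_ge_mean:
  fixes u :: real
  assumes "0 \<le> u" "u \<le> pi / 2"
  shows "u * (1 + cos u) \<le> 2 * sin u"
proof -
  define v where "v = u / 2"
  have v: "0 \<le> v" "v \<le> pi / 2" "u = 2 * v" using assms by (auto simp: v_def)
  have "sin 0 - 0 * cos 0 \<le> sin v - v * cos v"
  proof (rule DERIV_nonneg_imp_nondecreasing[OF v(1)])
    fix x assume x: "0 \<le> x" "x \<le> v"
    have "((\<lambda>x. sin x - x * cos x) has_real_derivative x * sin x) (at x)"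
      by (auto intro!: derivative_eq_intros)
    moreover have "x * sin x \<ge> 0" using x v by (intro mult_nonneg_nonneg sin_ge_zero) auto
    ultimately show "\<exists>y. ((\<lambda>x. sin x - x * cos x) has_real_derivative y) (at x) \<and> 0 \<le> y" by blast
  qed
  hence sv: "v * cos v \<le> sin v" by simp
  have cv: "cos v \<ge> 0" using v by (intro cos_ge_zero) auto
  have "u * (1 + cos u) = 4 * cos v * (v * cos v)"
    unfolding v(3) cos_double_cos by (simp add: power2_eq_square)
  also have "\<dots> \<le> 4 * cos v * sin v" using sv cv by (intro mult_left_mono) auto
  also have "\<dots> = 2 * sin u" unfolding v(3) sin_double by simp
  finally show ?thesis .
qed

text \<open>
  Multiplied by \<open>4 * cos u \<le> (1 + cos u)\<^sup>2\<close>, the previous estimate gives this one.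
\<close>

lemma sin_sq_ge_sq_times_cos:
  fixes u :: real
  assumes "0 \<le> u" "u \<le> pi / 2"
  shows "u ^ 2 * cos u \<le> sin u ^ 2"
proof -
  have c0: "cos u \<ge> 0" using assms by (intro cos_ge_zero) auto
  have "(u * (1 + cos u)) ^ 2 \<le> (2 * sin u) ^ 2"
    using assms c0 sin_ge_mean[OF assms] by (intro power_mono) auto
  moreover have "4 * cos u \<le> (1 + cos u) ^ 2"
    using zero_le_power2[of "1 - cos u"] by (simp add: power2_eq_square algebra_simps)
  hence "u ^ 2 * (4 * cos u) \<le> u ^ 2 * (1 + cos u) ^ 2" by (intro mult_left_mono) auto
  ultimately show ?thesis by (simp add: power_mult_distrib)
qed

text \<open>
  What remains of the kernel, as a function of the angle \<open>t\<close>, after its singularity at \<open>t = 0\<close> has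
  been split off. Since \<open>0 powr x = 0\<close>, the value at \<open>0\<close> is \<open>0\<close>, which is not above the other values
  and so compatible with monotonicity.
\<close>

definition kernel_remainder :: "real \<Rightarrow> real \<Rightarrow> real" where
  "kernel_remainder s t = (2 * sin (t / 2)) powr (-s) - t powr (-s)"

lemma kernel_remainder_0 [simp]: "kernel_remainder s 0 = 0"
  by (simp add: kernel_remainder_def)

text \<open>
  With \<open>z = 2 * sin (t / 2)\<close> and \<open>u = t / 2\<close>, the derivative is nonnegative if and only if
  \<open>cos u \<le> (z / t) powr (s + 1)\<close>. For \<open>s \<le> 1\<close> the right-hand side is at least
  \<open>(z / t)\<^sup>2 = (sin u / u)\<^sup>2\<close>, and \<open>sin_sq_ge_sq_times_cos\<close> applies.
\<close>

lemma kernel_remainder_mono: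
  assumes s: "0 < s" "s \<le> 1"
  shows "mono_on {0..pi} (kernel_remainder s)"
proof (rule mono_onI)
  fix x y :: real assume xy: "x \<in> {0..pi}" "y \<in> {0..pi}" "x \<le> y"
  have sin_pos: "sin (t / 2) > 0" if "0 < t" "t \<le> pi" for t
    using that by (intro sin_gt_zero) auto
  have sin_le: "2 * sin (t / 2) \<le> t" if "0 \<le> t" for t :: real
    using sin_x_le_x[of "t / 2"] that by simp
  show "kernel_remainder s x \<le> kernel_remainder s y"
  proof (cases "x = 0")
    case True
    thus ?thesis using sin_le[of y] sin_pos[of y] xy s
      by (cases "y = 0") (auto simp: kernel_remainder_def intro!: powr_mono2')
  next
    case False
    show ?thesis
    proof (rule DERIV_nonneg_imp_nondecreasing[OF xy(3)])
      fix t assume "x \<le> t" "t \<le> y"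
      hence t: "0 < t" "t \<le> pi" using False xy by auto
      define z where "z = 2 * sin (t / 2)"
      have z: "0 < z" "z \<le> t" using sin_pos[OF t] sin_le[of t] t by (auto simp: z_def)
      define D where "D = s * (t powr (-s-1) - cos (t / 2) * z powr (-s-1))"
      have "(kernel_remainder s has_real_derivative D) (at t)"
        unfolding kernel_remainder_def[abs_def] using t z
        by (auto intro!: derivative_eq_intros simp: D_def z_def field_simps)
      moreover have "D \<ge> 0"
      proof -
        have "(t / 2) ^ 2 * cos (t / 2) \<le> sin (t / 2) ^ 2"
          using t by (intro sin_sq_ge_sq_times_cos) auto
        hence "cos (t / 2) \<le> (z / t) ^ 2" using t by (simp add: z_def power_divide field_simps)
        also have "\<dots> = (z / t) powr 2" using z t by simp
        also have "\<dots> \<le> (z / t) powr (s + 1)" using z t s by (intro powr_mono') auto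
        finally have "cos (t / 2) * z powr (-s-1) \<le> (z / t) powr (s + 1) * z powr (-s-1)"
          by (intro mult_right_mono) auto
        also have "(z / t) powr (s + 1) = z powr (s + 1) * t powr (-s-1)"
        proof -
          have "t powr (-s-1) = inverse (t powr (s + 1))" using powr_minus[of t "s + 1"] by simp
          thus ?thesis using z t by (subst powr_divide) (auto simp: divide_inverse)
        qed
        also have "z powr (s + 1) * t powr (-s-1) * z powr (-s-1) = t powr (-s-1) * (z powr (s + 1) * z powr (-s-1))"
          by simp
        also have "z powr (s + 1) * z powr (-s-1) = 1" using z by (simp flip: powr_add)
        finally show ?thesis using s by (simp add: D_def)
      qed
      ultimately show "\<exists>y. (kernel_remainder s has_real_derivative y) (at t) \<and> 0 \<le> y" by blast
    qed
  qed
qed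

lemma sum_lessThan_add:
  fixes g :: "nat \<Rightarrow> real"
  shows "(\<Sum>k<m + n. g k) = (\<Sum>k<m. g k) + (\<Sum>k<n. g (m + k))"
  by (induction n) (simp_all add: add.assoc)

text \<open>
  The upper and the lower half of the circle contribute equally, so the chord lengths need to be
  known only for angles up to \<open>pi\<close>, where the kernel has a single singularity.
\<close>

lemma midpoint_potential_double:
  assumes "m > 0"
  shows "midpoint_potential s (2 * m) =
    2 * (\<Sum>k<m. kernel_profile s (2 * sin (pi * (2 * real k + 1) / (2 * real m) / 2)))"
proof -
  define g where "g = (\<lambda>k. kernel_profile s (2 * sin (pi * (2 * real k + 1) / (2 * real (2 * m)))))"
  have refl: "g (m + k) = g (m - Suc k)" if "k < m" for k
  proof -
    have "real (m - Suc k) = real m - real k - 1" using that by (simp add: of_nat_diff)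
    hence "pi * (2 * real (m + k) + 1) / (2 * real (2 * m)) =
        pi - pi * (2 * real (m - Suc k) + 1) / (2 * real (2 * m))"
      using assms by (simp add: divide_simps) (simp add: algebra_simps)
    thus ?thesis unfolding g_def by (simp only: sin_pi_minus)
  qed
  have "midpoint_potential s (2 * m) = (\<Sum>k<m + m. g k)"
    by (simp only: midpoint_potential_def g_def mult_2[symmetric])
  also have "\<dots> = (\<Sum>k<m. g k) + (\<Sum>k<m. g (m + k))" by (rule sum_lessThan_add)
  also have "(\<Sum>k<m. g (m + k)) = (\<Sum>k<m. g (m - Suc k))" using refl by (intro sum.cong) auto
  also have "\<dots> = (\<Sum>k<m. g k)" by (rule sum.nat_diff_reindex)
  finally show ?thesis by (simp add: g_def)
qed

lemma sum_powr_angles: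
  assumes "m > 0"
  shows "(\<Sum>k<m. (pi * (2 * real k + 1) / (2 * real m)) powr (-s)) =
    (2 * real m) powr s * pi powr (-s) * odd_partial s m"
proof -
  have "(pi * (2 * real k + 1) / (2 * real m)) powr (-s) =
      (2 * real m) powr s * pi powr (-s) * (2 * real k + 1) powr (-s)" for k
    using assms by (simp add: powr_divide powr_mult powr_minus_divide)
  thus ?thesis by (simp add: odd_partial_def sum_distrib_left)
qed

text \<open>
  Splitting off the singularity leaves an explicit sum over odd numbers and a Riemann sum of the
  monotone function \<open>kernel_remainder s\<close>, to which the midpoint rule applies with bounded error.
\<close>

lemma midpoint_potential_remainder:
  assumes s: "0 < s" "s \<le> 1" and m: "m > 0"
  shows "\<bar>midpoint_potential s (2 * m) / (2 * real m) powr s - 2 * pi powr (-s) * odd_partial s m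
            - (2 * real m) powr (1 - s) * (integral {0..pi} (kernel_remainder s) / pi)\<bar>
         \<le> 2 * kernel_remainder s pi * (2 * real m) powr (-s)"
proof -
  define M where "M = 2 * real m"
  define J where "J = integral {0..pi} (kernel_remainder s)"
  define t where "t = (\<lambda>k. pi * (2 * real k + 1) / (2 * real m))"
  have M: "M > 0" using m by (simp add: M_def)
  have mp: "midpoint_potential s (2 * m) = 2 * ((\<Sum>k<m. t k powr (-s)) + (\<Sum>k<m. kernel_remainder s (t k)))"
  proof -
    have "kernel_profile s (2 * sin (x / 2)) = x powr (-s) + kernel_remainder s x" for x
      using s by (simp add: kernel_remainder_def kernel_profile_def)
    thus ?thesis unfolding midpoint_potential_double[OF m] sum.distrib[symmetric] t_def by (simp only:)
  qed
  have "\<bar>(\<Sum>k<m. kernel_remainder s (t k)) - real m / pi * J\<bar> \<le> kernel_remainder s pi"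
    using midpoint_rule_monotone[OF kernel_remainder_mono[OF s] pi_gt_zero m] by (simp add: t_def J_def)
  hence "M powr (-s) * \<bar>2 * (\<Sum>k<m. kernel_remainder s (t k)) - M / pi * J\<bar> \<le> M powr (-s) * (2 * kernel_remainder s pi)"
    by (intro mult_left_mono) (auto simp: M_def abs_le_iff)
  also have "M powr (-s) * \<bar>2 * (\<Sum>k<m. kernel_remainder s (t k)) - M / pi * J\<bar> =
      \<bar>M powr (-s) * (2 * (\<Sum>k<m. kernel_remainder s (t k)) - M / pi * J)\<bar>"
    by (simp add: abs_mult)
  also have "M powr (-s) * (2 * (\<Sum>k<m. kernel_remainder s (t k)) - M / pi * J) =
      midpoint_potential s (2 * m) / M powr s - 2 * pi powr (-s) * odd_partial s m - M powr (1 - s) * (J / pi)"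
  proof -
    have "M powr (1 - s) = M * M powr (-s)" using M powr_add[of M 1 "-s"] by simp
    moreover have "(\<Sum>k<m. t k powr (-s)) = M powr s * pi powr (-s) * odd_partial s m"
      unfolding t_def M_def by (rule sum_powr_angles[OF m])
    ultimately show ?thesis unfolding mp using M by (simp add: powr_minus field_simps)
  qed
  finally show ?thesis by (simp add: M_def J_def mult_ac)
qed

lemma midpoint_potential_remainder_limit:
  assumes s: "0 < s" "s \<le> 1"
  shows "(\<lambda>m. midpoint_potential s (2 * m) / (2 * real m) powr s - 2 * pi powr (-s) * odd_partial s m
            - (2 * real m) powr (1 - s) * (integral {0..pi} (kernel_remainder s) / pi)) \<longlonglongrightarrow> 0"
proof (rule Lim_null_comparison)
  show "eventually (\<lambda>m. norm (midpoint_potential s (2 * m) / (2 * real m) powr s - 2 * pi powr (-s) * odd_partial s m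
            - (2 * real m) powr (1 - s) * (integral {0..pi} (kernel_remainder s) / pi))
         \<le> 2 * kernel_remainder s pi * (2 * real m) powr (-s)) sequentially"
    using eventually_gt_at_top[of 0] by eventually_elim (use midpoint_potential_remainder[OF s] in simp)
  show "(\<lambda>m. 2 * kernel_remainder s pi * (2 * real m) powr (-s)) \<longlonglongrightarrow> 0" using s by real_asymp
qed

lemma kernel_has_integral:
  assumes s: "0 < s" "s < 1"
  shows "((\<lambda>t. (2 * sin (t / 2)) powr (-s)) has_integral
     integral {0..pi} (kernel_remainder s) + pi powr (1 - s) / (1 - s)) {0..pi}"
proof -
  have "kernel_remainder s integrable_on {0..pi}"
    by (rule integrable_on_mono_on, rule kernel_remainder_mono) (use s in auto)
  hence "((\<lambda>t. kernel_remainder s t + t powr (-s)) has_integral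
     integral {0..pi} (kernel_remainder s) + pi powr (-s + 1) / (-s + 1)) {0..pi}"
    by (intro has_integral_add has_integral_powr_from_0 integrable_integral) (use s in auto)
  thus ?thesis by (simp add: kernel_remainder_def add.commute)
qed

lemma zeta_constant_eq:
  assumes "s > 0"
  shows "2 * pi powr (-s) * ((1 - 2 powr (-s)) * z) = 2 * (2 powr s - 1) * (2 * pi) powr (-s) * z"
  by (simp add: powr_mult powr_minus field_simps)

text \<open>
  The linear term \<open>(2 * m) * I\<close> collects the integral of the remainder and the divergent part of the
  sum over odd numbers; the next term is governed by the zeta function.
\<close>

lemma midpoint_potential_limit_less_1:
  assumes s: "0 < s" "s < 1"
  defines "I \<equiv> integral {0..pi} (\<lambda>t. (2 * sin (t / 2)) powr (-s)) / pi"
  shows "(\<lambda>m. midpoint_potential s (2 * m) / (2 * real m) powr s - (2 * real m) powr (1 - s) * I)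
     \<longlonglongrightarrow> 2 * (2 powr s - 1) * (2 * pi) powr (-s) * Re (riemann_zeta (of_real s))"
proof -
  define J where "J = integral {0..pi} (kernel_remainder s)"
  have I: "I = (J + pi powr (1 - s) / (1 - s)) / pi"
    using integral_unique[OF kernel_has_integral[OF s]] by (simp add: I_def J_def)
  have "(\<lambda>m. (midpoint_potential s (2 * m) / (2 * real m) powr s - 2 * pi powr (-s) * odd_partial s m
            - (2 * real m) powr (1 - s) * (J / pi)) +
        2 * pi powr (-s) * (odd_partial s m - 2 powr (-s) * real m powr (1 - s) / (1 - s)))
     \<longlonglongrightarrow> 0 + 2 * pi powr (-s) * ((1 - 2 powr (-s)) * Re (riemann_zeta (of_real s)))"
    using s unfolding J_def
    by (intro tendsto_add tendsto_mult tendsto_const midpoint_potential_remainder_limit odd_partial_limit) auto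
  also have "(\<lambda>m. (midpoint_potential s (2 * m) / (2 * real m) powr s - 2 * pi powr (-s) * odd_partial s m
            - (2 * real m) powr (1 - s) * (J / pi)) +
        2 * pi powr (-s) * (odd_partial s m - 2 powr (-s) * real m powr (1 - s) / (1 - s))) =
      (\<lambda>m. midpoint_potential s (2 * m) / (2 * real m) powr s - (2 * real m) powr (1 - s) * I)"
  proof
    fix m
    have e: "2 powr (1 - s) = 2 * 2 powr (-s)" "pi powr (1 - s) = pi * pi powr (-s)"
      using powr_add[of 2 1 "-s"] powr_add[of pi 1 "-s"] by simp_all
    have "(2 * real m) powr (1 - s) * (pi powr (1 - s) / (1 - s)) / pi =
      2 * pi powr (-s) * (2 powr (-s) * real m powr (1 - s) / (1 - s))"
      by (simp add: powr_mult e)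
    hence "(2 * real m) powr (1 - s) * I = (2 * real m) powr (1 - s) * (J / pi) +
       2 * pi powr (-s) * (2 powr (-s) * real m powr (1 - s) / (1 - s))"
      unfolding I by (simp add: add_divide_distrib distrib_left)
    thus "(midpoint_potential s (2 * m) / (2 * real m) powr s - 2 * pi powr (-s) * odd_partial s m
            - (2 * real m) powr (1 - s) * (J / pi)) +
        2 * pi powr (-s) * (odd_partial s m - 2 powr (-s) * real m powr (1 - s) / (1 - s)) =
      midpoint_potential s (2 * m) / (2 * real m) powr s - (2 * real m) powr (1 - s) * I"
      by (simp add: right_diff_distrib)
  qed
  finally show ?thesis using zeta_constant_eq[OF s(1)] by simp
qed

text \<open>
  An antiderivative is \<open>ln (tan (t / 4) / t)\<close>, which extends continuously to \<open>0\<close>.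
\<close>

lemma integral_kernel_remainder_1: "integral {0..pi} (kernel_remainder 1) = ln (4 / pi)"
proof -
  define Q where "Q = (\<lambda>t::real. if t = 0 then ln (1 / 4) else ln (tan (t / 4) / t))"
  have tpos: "tan (t / 4) > 0" if "0 < t" "t \<le> pi" for t
    using that by (intro tan_gt_zero) auto
  have der: "(Q has_real_derivative kernel_remainder 1 t) (at t)" if t: "0 < t" "t \<le> pi" for t
  proof -
    have c: "cos (t / 4) > 0" "sin (t / 4) > 0" using t by (auto intro!: cos_gt_zero sin_gt_zero)
    have s: "sin (t / 2) = 2 * sin (t / 4) * cos (t / 4)" using sin_double[of "t / 4"] by simp
    have "((\<lambda>t. ln (tan (t / 4)) - ln t) has_real_derivative kernel_remainder 1 t) (at t)"
      using t c tpos[OF t]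
      by (auto intro!: derivative_eq_intros simp: kernel_remainder_def s powr_minus tan_def field_simps power2_eq_square)
    moreover have "eventually (\<lambda>t. t \<in> {0<..<2 * pi}) (nhds t)"
      using t by (intro eventually_nhds_in_open) auto
    hence "eventually (\<lambda>t. Q t = ln (tan (t / 4)) - ln t) (nhds t)"
    proof eventually_elim
      case (elim t)
      hence "tan (t / 4) > 0" by (intro tan_gt_zero) auto
      thus ?case using elim by (simp add: Q_def ln_div)
    qed
    ultimately show ?thesis by (subst DERIV_cong_ev[OF refl _ refl]) auto
  qed
  have cont: "continuous_on {0..pi} Q"
    unfolding continuous_on_eq_continuous_within
  proof
    fix t assume t: "t \<in> {0..pi}"
    show "continuous (at t within {0..pi}) Q"
    proof (cases "t = 0")
      case False
      thus ?thesis using der[of t] t DERIV_isCont continuous_at_imp_continuous_at_within by force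
    next
      case True
      have "((\<lambda>t. tan (t / 4) / t) \<longlongrightarrow> 1 / 4) (at_right (0::real))" by real_asymp
      hence "((\<lambda>t. ln (tan (t / 4) / t)) \<longlongrightarrow> ln (1 / 4)) (at_right (0::real))"
        by (intro tendsto_ln) auto
      hence "(Q \<longlongrightarrow> ln (1 / 4)) (at_right 0)"
        by (rule Lim_transform_eventually) (auto simp: Q_def eventually_at_filter)
      hence "(Q \<longlongrightarrow> Q 0) (at_right 0)" by (simp add: Q_def)
      thus ?thesis using True pi_gt_zero by (simp add: continuous_within at_within_Icc_at_right)
    qed
  qed
  have "(kernel_remainder 1 has_integral Q pi - Q 0) {0..pi}"
    using cont der
    by (intro fundamental_theorem_of_calculus_interior) (auto simp: has_real_derivative_iff_has_vector_derivative)
  moreover have "Q pi - Q 0 = ln (4 / pi)"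
    by (simp add: Q_def tan_45 ln_div)
  ultimately show ?thesis by (simp add: integral_unique)
qed

lemma midpoint_potential_limit_1:
  "(\<lambda>m. midpoint_potential 1 (2 * m) / (2 * real m) - ln (2 * real m) / pi)
     \<longlonglongrightarrow> 1 / pi * (euler_mascheroni + ln (8 / pi))"
proof -
  have "(\<lambda>m. (midpoint_potential 1 (2 * m) / (2 * real m) powr 1 - 2 * pi powr (-1) * odd_partial 1 m
            - (2 * real m) powr (1 - 1) * (integral {0..pi} (kernel_remainder 1) / pi)) +
        2 * pi powr (-1) * (odd_partial 1 m - ln (real m) / 2) + (ln (4 / pi) - ln 2) / pi)
     \<longlonglongrightarrow> 0 + 2 * pi powr (-1) * (ln 2 + euler_mascheroni / 2) + (ln (4 / pi) - ln 2) / pi"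
    by (intro tendsto_add tendsto_mult tendsto_const midpoint_potential_remainder_limit odd_partial_limit_harmonic) auto
  also have "0 + 2 * pi powr (-1) * (ln 2 + euler_mascheroni / 2) + (ln (4 / pi) - ln 2) / pi =
     1 / pi * (euler_mascheroni + (ln 2 + ln (4 / pi)))"
    by (simp add: powr_minus field_simps)
  also have "ln 2 + ln (4 / pi) = ln (2 * (4 / pi))" by (subst ln_mult) auto
  finally have "(\<lambda>m. (midpoint_potential 1 (2 * m) / (2 * real m) powr 1 - 2 * pi powr (-1) * odd_partial 1 m
            - (2 * real m) powr (1 - 1) * (integral {0..pi} (kernel_remainder 1) / pi)) +
        2 * pi powr (-1) * (odd_partial 1 m - ln (real m) / 2) + (ln (4 / pi) - ln 2) / pi)
     \<longlonglongrightarrow> 1 / pi * (euler_mascheroni + ln (8 / pi))" by simp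
  moreover have "eventually (\<lambda>m. (midpoint_potential 1 (2 * m) / (2 * real m) powr 1 - 2 * pi powr (-1) * odd_partial 1 m
            - (2 * real m) powr (1 - 1) * (integral {0..pi} (kernel_remainder 1) / pi)) +
        2 * pi powr (-1) * (odd_partial 1 m - ln (real m) / 2) + (ln (4 / pi) - ln 2) / pi =
      midpoint_potential 1 (2 * m) / (2 * real m) - ln (2 * real m) / pi) sequentially"
    using eventually_gt_at_top[of 0]
  proof eventually_elim
    case (elim m)
    have alg: "(X - 2 * (1 / pi) * R - 1 * (L / pi)) + 2 * (1 / pi) * (R - l / 2) + (L - ln 2) / pi =
        X - (ln 2 + l) / pi" for X R L l
      by (simp add: field_simps)
    have e: "pi powr (-1) = 1 / pi" "(2 * real m) powr 1 = 2 * real m" "(2 * real m) powr (1 - 1) = 1"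
      "ln (2 * real m) = ln 2 + ln (real m)"
      using elim by (simp_all add: powr_minus_divide ln_mult)
    show ?case unfolding integral_kernel_remainder_1 e by (rule alg)
  qed
  ultimately show ?thesis by (rule Lim_transform_eventually)
qed

text \<open>
  For \<open>s > 1\<close> the nearest neighbours dominate. After division by \<open>(2 * m) powr s\<close> each term converges
  to \<open>(pi * (2 * k + 1)) powr (-s)\<close>, and since \<open>sin u \<ge> u / 2\<close> on the first quadrant, the terms are
  dominated by a convergent series; Tannery's theorem allows the exchange of the limits.
\<close>

lemma midpoint_potential_limit_greater_1:
  assumes s: "s > 1"
  shows "(\<lambda>m. midpoint_potential s (2 * m) / (2 * real m) powr s)
     \<longlonglongrightarrow> 2 * (2 powr s - 1) * (2 * pi) powr (-s) * Re (riemann_zeta (of_real s))"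
proof -
  define c where "c = (\<lambda>k::nat. pi * (2 * real k + 1))"
  define a where "a = (\<lambda>k m::nat. if k < m then (4 * real m * sin (c k / (4 * real m))) powr (-s) else 0)"
  define b where "b = (\<lambda>k. c k powr (-s))"
  have c: "c k > 0" for k by (auto simp: c_def intro!: mult_pos_pos)
  have lim: "(\<lambda>m. a k m) \<longlonglongrightarrow> b k" for k
  proof -
    have "(\<lambda>m::nat. 4 * real m * sin (c k / (4 * real m))) \<longlonglongrightarrow> c k" by real_asymp
    hence "(\<lambda>m::nat. (4 * real m * sin (c k / (4 * real m))) powr (-s)) \<longlonglongrightarrow> c k powr (-s)"
      using c[of k] by (intro tendsto_powr) auto
    moreover have "eventually (\<lambda>m. (4 * real m * sin (c k / (4 * real m))) powr (-s) = a k m) sequentially"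
      using eventually_gt_at_top[of k] by eventually_elim (simp add: a_def)
    ultimately show ?thesis unfolding b_def by (rule Lim_transform_eventually)
  qed
  have bound: "norm (a k m) \<le> real (Suc k) powr (-s)" for k m
  proof (cases "k < m")
    case True
    define u where "u = c k / (4 * real m)"
    have "pi * (2 * real k + 1) \<le> pi * (2 * real m)" using True by (intro mult_left_mono) auto
    hence u: "0 \<le> u" "u \<le> pi / 2" using True c[of k] by (auto simp: u_def c_def field_simps)
    have "u * 1 \<le> u * (1 + cos u)" using u by (intro mult_left_mono) (auto intro!: cos_ge_zero)
    hence "u \<le> 2 * sin u" using sin_ge_mean[OF u] by simp
    hence "4 * real m * u \<le> 4 * real m * (2 * sin u)" by (intro mult_left_mono) auto
    moreover have "4 * real m * u = c k" using True by (simp add: u_def)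
    moreover have "2 * (2 * real k + 1) \<le> c k"
      unfolding c_def using pi_ge_two by (intro mult_right_mono) auto
    ultimately have "real (Suc k) \<le> 4 * real m * sin u" by simp
    hence "(4 * real m * sin u) powr (-s) \<le> real (Suc k) powr (-s)"
      using s by (intro powr_mono2') auto
    thus ?thesis using True by (simp add: a_def u_def)
  qed (simp add: a_def)
  have "summable (\<lambda>k. real (Suc k) powr (-s))" using s by (intro summable_Suc_powr) auto
  from tannerys_theorem[OF lim always_eventually this sequentially_bot] bound
  have T: "summable (\<lambda>k. norm (b k))" "(\<lambda>m. \<Sum>k. a k m) \<longlonglongrightarrow> suminf b" by auto
  have "suminf b = pi powr (-s) * ((1 - 2 powr (-s)) * Re (riemann_zeta (of_real s)))"
  proof (rule LIMSEQ_unique)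
    show "(\<lambda>m. \<Sum>k<m. b k) \<longlonglongrightarrow> suminf b"
      using summable_norm_cancel[OF T(1)] by (rule summable_LIMSEQ)
    have 0: "(\<lambda>m. 2 powr (-s) * real m powr (1 - s) / (1 - s)) \<longlonglongrightarrow> 0"
      using s by real_asymp
    have "odd_partial s \<longlonglongrightarrow> (1 - 2 powr (-s)) * Re (riemann_zeta (of_real s))"
      using tendsto_add[OF odd_partial_limit[of s] 0] s by simp
    from tendsto_mult[OF tendsto_const[of "pi powr (-s)"] this]
    show "(\<lambda>m. \<Sum>k<m. b k) \<longlonglongrightarrow> pi powr (-s) * ((1 - 2 powr (-s)) * Re (riemann_zeta (of_real s)))"
      by (simp add: b_def c_def odd_partial_def powr_mult sum_distrib_left)
  qed
  hence "(\<lambda>m. 2 * (\<Sum>k. a k m)) \<longlonglongrightarrow>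
      2 * (pi powr (-s) * ((1 - 2 powr (-s)) * Re (riemann_zeta (of_real s))))"
    using T(2) by (intro tendsto_mult tendsto_const) simp
  moreover have "eventually (\<lambda>m. 2 * (\<Sum>k. a k m) = midpoint_potential s (2 * m) / (2 * real m) powr s) sequentially"
    using eventually_gt_at_top[of 0]
  proof eventually_elim
    case (elim m)
    have "(\<Sum>k. a k m) = (\<Sum>k<m. a k m)" by (rule suminf_finite) (auto simp: a_def)
    also have "\<dots> = (\<Sum>k<m. kernel_profile s (2 * sin (pi * (2 * real k + 1) / (2 * real m) / 2)) / (2 * real m) powr s)"
    proof (intro sum.cong refl)
      fix k assume k: "k \<in> {..<m}"
      define u where "u = c k / (4 * real m)"
      have "pi * (2 * real k + 1) \<le> pi * (2 * real m)" using k by (intro mult_left_mono) auto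
      hence u: "0 < u" "u < pi" using k c[of k] pi_gt_zero by (auto simp: u_def c_def field_simps)
      have "(2 * sin u) powr (-s) / (2 * real m) powr s = (2 * sin u) powr (-s) * (2 * real m) powr (-s)"
        by (simp add: powr_minus_divide)
      also have "\<dots> = (2 * sin u * (2 * real m)) powr (-s)"
        using sin_gt_zero[OF u] by (subst powr_mult) auto
      also have "2 * sin u * (2 * real m) = 4 * real m * sin u" by simp
      finally show "a k m = kernel_profile s (2 * sin (pi * (2 * real k + 1) / (2 * real m) / 2)) / (2 * real m) powr s"
        using k s by (simp add: a_def kernel_profile_def u_def c_def)
    qed
    finally show ?case by (simp only: midpoint_potential_double[OF elim] sum_divide_distrib[symmetric] times_divide_eq_right)
  qed
  ultimately have "(\<lambda>m. midpoint_potential s (2 * m) / (2 * real m) powr s) \<longlonglongrightarrow>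
      2 * (pi powr (-s) * ((1 - 2 powr (-s)) * Re (riemann_zeta (of_real s))))"
    by (rule Lim_transform_eventually)
  thus ?thesis using s by (subst zeta_constant_eq[symmetric]) (simp_all add: mult.assoc)
qed

text \<open>
  Doubling the number of vertices does not change the value: by the formula
  \<open>2 * sin (2 * x) = (2 * sin x) * (2 * sin (x + pi / 2))\<close> the new chords, grouped in pairs, have
  the old chords as products.
\<close>

lemma midpoint_potential_0: "midpoint_potential 0 (2 ^ n) = - ln 2"
proof (induction n)
  case 0
  show ?case by (simp add: midpoint_potential_def kernel_profile_def)
next
  case (Suc n)
  define M where "M = (2::nat) ^ n"
  have M: "M > 0" by (simp add: M_def)
  define \<theta> where "\<theta> = (\<lambda>k. pi * (2 * real k + 1) / (2 * real M))"
  have \<theta>: "0 < \<theta> k" "\<theta> k < pi" if "k < M" for k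
  proof -
    have "pi * (2 * real k + 1) < pi * (2 * real M)" using that by (intro mult_strict_left_mono) auto
    thus "0 < \<theta> k" "\<theta> k < pi" using M by (auto simp: \<theta>_def field_simps intro!: divide_pos_pos add_pos_nonneg)
  qed
  define g where "g = (\<lambda>k. kernel_profile 0 (2 * sin (pi * (2 * real k + 1) / (2 * real (2 * M)))))"
  have g: "g k + g (M + k) = kernel_profile 0 (2 * sin (\<theta> k))" if k: "k < M" for k
  proof -
    have 1: "pi * (2 * real k + 1) / (2 * real (2 * M)) = \<theta> k / 2" by (simp add: \<theta>_def)
    have 2: "pi * (2 * real (M + k) + 1) / (2 * real (2 * M)) = \<theta> k / 2 + pi / 2"
      using M by (simp add: \<theta>_def field_simps)
    have s: "sin (\<theta> k / 2) > 0" using \<theta>[OF k] by (intro sin_gt_zero) auto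
    have c: "cos (\<theta> k / 2) > 0" using \<theta>[OF k] by (intro cos_gt_zero) auto
    have "ln (2 * sin (\<theta> k / 2)) + ln (2 * cos (\<theta> k / 2)) = ln ((2 * sin (\<theta> k / 2)) * (2 * cos (\<theta> k / 2)))"
      by (rule ln_mult_pos[symmetric]) (use s c in auto)
    also have "(2 * sin (\<theta> k / 2)) * (2 * cos (\<theta> k / 2)) = 2 * (2 * sin (\<theta> k / 2) * cos (\<theta> k / 2))"
      by simp
    also have "2 * sin (\<theta> k / 2) * cos (\<theta> k / 2) = sin (\<theta> k)"
      using sin_double[of "\<theta> k / 2"] by simp
    finally show ?thesis unfolding g_def 1 2 by (simp add: kernel_profile_def sin_add)
  qed
  have "midpoint_potential 0 (2 ^ Suc n) = (\<Sum>k<M + M. g k)"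
    by (simp only: midpoint_potential_def g_def M_def mult_2[symmetric] power_Suc)
  also have "\<dots> = (\<Sum>k<M. g k + g (M + k))" by (simp add: sum_lessThan_add sum.distrib)
  also have "\<dots> = midpoint_potential 0 M" using g by (simp add: midpoint_potential_def \<theta>_def)
  finally show ?case using Suc by (simp add: M_def)
qed

section \<open>The Riesz energy of the circle\<close>

text \<open>
  This is the rotation invariance of the circle: the piece of the period that the shift
  moves across \<open>0\<close> is cut off and put back at the other end.
\<close>

lemma has_integral_periodic_shift:
  fixes p :: "real \<Rightarrow> real"
  assumes per: "\<And>u. p (u + T) = p u" and int: "(p has_integral I) {0..T}" and \<theta>: "\<theta> \<in> {0..T}"
  shows "((\<lambda>\<phi>. p (\<phi> - \<theta>)) has_integral I) {0..T}"
proof -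
  have io: "p integrable_on {0..T}" using int by (rule has_integral_integrable)
  have 1: "(p has_integral integral {0..T-\<theta>} p) {0..T-\<theta>}" "(p has_integral integral {T-\<theta>..T} p) {T-\<theta>..T}"
    using \<theta> by (auto intro!: integrable_integral integrable_on_subinterval[OF io])
  have I: "I = integral {0..T-\<theta>} p + integral {T-\<theta>..T} p"
    using Henstock_Kurzweil_Integration.integral_combine[OF _ _ io, of "T - \<theta>"] \<theta> integral_unique[OF int] by simp
  have "((\<lambda>\<phi>. p (\<phi> - \<theta>)) has_integral integral {T-\<theta>..T} p) {0..\<theta>}"
    using has_integral_shift_Icc_real[of p "T - \<theta>" "integral {T-\<theta>..T} p" 0 \<theta>] 1(2) per[of "x - \<theta>" for x]
    by (simp add: o_def algebra_simps)
  moreover have "((\<lambda>\<phi>. p (\<phi> - \<theta>)) has_integral integral {0..T-\<theta>} p) {\<theta>..T}"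
    using has_integral_shift_Icc_real[of p "-\<theta>" "integral {0..T-\<theta>} p" \<theta> T] 1(1)
    by (simp add: o_def algebra_simps)
  ultimately show ?thesis
    unfolding I using \<theta> has_integral_combine[of 0 \<theta> T "\<lambda>\<phi>. p (\<phi> - \<theta>)"]
    by (metis add.commute atLeastAtMost_iff)
qed

lemma sets_circle_measure [measurable_cong]: "sets circle_measure = sets borel"
  by (simp add: circle_measure_def)

lemma finite_circle_measure: "finite_measure circle_measure"
proof -
  have [measurable]: "cis \<in> borel_measurable borel"
    by (intro borel_measurable_continuous_onI continuous_intros)
  have "emeasure circle_measure (space circle_measure) = 1"
    unfolding circle_measure_def by (subst emeasure_distr) (simp_all add: emeasure_uniform_measure)
  thus ?thesis by (intro finite_measureI) simp
qed

lemma integral_circle_nonneg: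
  fixes g :: "complex \<Rightarrow> real"
  assumes [measurable]: "g \<in> borel_measurable borel" and "\<And>z. g z \<ge> 0"
    and I: "((\<lambda>t. g (cis t)) has_integral I) {0..2*pi}"
  shows "(\<integral>z. g z \<partial>circle_measure) = I / (2 * pi)"
proof -
  have [measurable]: "cis \<in> borel_measurable borel"
    by (intro borel_measurable_continuous_onI continuous_intros)
  have I0: "I \<ge> 0" using has_integral_nonneg[OF I] assms by auto
  have "(\<integral>z. g z \<partial>circle_measure) = (\<integral>t. g (cis t) \<partial>uniform_measure lborel {0..2*pi})"
    unfolding circle_measure_def by (rule integral_distr) auto
  also have "\<dots> = enn2real (\<integral>\<^sup>+t. ennreal (g (cis t)) \<partial>uniform_measure lborel {0..2*pi})"
    by (rule integral_eq_nn_integral) (use assms in auto)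
  also have "(\<integral>\<^sup>+t. ennreal (g (cis t)) \<partial>uniform_measure lborel {0..2*pi}) =
      (\<integral>\<^sup>+t. ennreal (g (cis t)) * indicator {0..2*pi} t \<partial>lborel) / emeasure lborel {0..2*pi}"
    by (rule nn_integral_uniform_measure) auto
  also have "(\<integral>\<^sup>+t. ennreal (g (cis t)) * indicator {0..2*pi} t \<partial>lborel) =
      (\<integral>\<^sup>+t. ennreal (g (cis t) * indicator {0..2*pi} t) \<partial>lborel)"
    by (intro nn_integral_cong) (auto split: split_indicator)
  also have "\<dots> = ennreal I"
  proof (rule nn_integral_has_integral_lborel)
    have "((\<lambda>t. if t \<in> {0..2*pi} then g (cis t) else 0) has_integral I) UNIV"
      using I by (subst has_integral_restrict_UNIV)
    also have "(\<lambda>t. if t \<in> {0..2*pi} then g (cis t) else 0) = (\<lambda>t. g (cis t) * indicator {0..2*pi} t)"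
      by (auto simp: fun_eq_iff)
    finally show "((\<lambda>t. g (cis t) * indicator {0..2*pi} t) has_integral I) UNIV" .
  qed (use assms in auto)
  also have "emeasure lborel {0..2*pi} = ennreal (2 * pi)" by simp
  also have "ennreal I / ennreal (2 * pi) = ennreal (I / (2 * pi))" using I0 by (intro divide_ennreal) auto
  finally show ?thesis using I0 by simp
qed

lemma dist_cis_cis: "dist (cis \<theta>) (cis \<phi>) = 2 * \<bar>sin ((\<phi> - \<theta>) / 2)\<bar>"
proof -
  have "cis \<phi> - cis \<theta> = cis ((\<phi> + \<theta>) / 2) * (cis ((\<phi> - \<theta>) / 2) - cis (- ((\<phi> - \<theta>) / 2)))"
    by (simp add: right_diff_distrib cis_mult field_simps)
  also have "cis ((\<phi> - \<theta>) / 2) - cis (- ((\<phi> - \<theta>) / 2)) = 2 * \<i> * sin ((\<phi> - \<theta>) / 2)"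
    by (simp add: complex_eq_iff)
  finally show ?thesis by (simp add: dist_norm norm_minus_commute[of "cis \<theta>"] norm_mult)
qed

text \<open>
  By rotation invariance the inner integral is the same for every point of the circle, and
  by reflection it is twice the integral over a half circle.
\<close>

lemma riesz_energy_eq:
  assumes s: "0 < s" "s < 1"
  shows "riesz_energy s = integral {0..pi} (\<lambda>t. (2 * sin (t / 2)) powr (-s)) / pi"
proof -
  define I where "I = integral {0..pi} (\<lambda>t. (2 * sin (t / 2)) powr (-s))"
  define p where "p = (\<lambda>u. (2 * \<bar>sin (u / 2)\<bar>) powr (-s))"
  have "((\<lambda>t. (2 * sin (t / 2)) powr (-s)) has_integral I) {0..pi}"
    unfolding I_def by (rule integrable_integral) (use kernel_has_integral[OF s] in blast)
  hence p1: "(p has_integral I) {0..pi}"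
    by (rule has_integral_eq[rotated]) (auto simp: p_def sin_ge_zero)
  have per: "p (u + 2 * pi) = p u" for u by (simp add: p_def add_divide_distrib)
  have "((\<lambda>u. p (- u)) has_integral I) {-pi..0}"
    using p1 by (subst has_integral_reflect_real[symmetric]) simp
  hence "(p has_integral I) {-pi..0}" by (simp add: p_def)
  hence "((p \<circ> (+) (- 2 * pi)) has_integral I) {pi..2 * pi}"
    by (subst has_integral_shift_Icc_real) simp
  moreover have "p \<circ> (+) (- 2 * pi) = p" using per[of "u - 2 * pi" for u] by (auto simp: fun_eq_iff)
  ultimately have "(p has_integral I) {pi..2 * pi}" by simp
  with p1 have p2: "(p has_integral 2 * I) {0..2 * pi}"
    using has_integral_combine[of 0 pi "2 * pi" p I I] by simp
  have inner: "(\<integral>y. dist (cis \<theta>) y powr (-s) \<partial>circle_measure) = I / pi" if "\<theta> \<in> {0..2*pi}" for \<theta>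
  proof -
    have "((\<lambda>t. dist (cis \<theta>) (cis t) powr (-s)) has_integral 2 * I) {0..2*pi}"
      using has_integral_periodic_shift[OF per p2 that] by (simp add: p_def dist_cis_cis)
    hence "(\<integral>y. dist (cis \<theta>) y powr (-s) \<partial>circle_measure) = 2 * I / (2 * pi)"
      by (intro integral_circle_nonneg) auto
    thus ?thesis by simp
  qed
  interpret c: finite_measure circle_measure by (rule finite_circle_measure)
  have "riesz_energy s = 2 * I / (2 * pi)"
    unfolding riesz_energy_def
  proof (rule integral_circle_nonneg)
    show "(\<lambda>x. \<integral>y. dist x y powr (-s) \<partial>circle_measure) \<in> borel_measurable borel"
      by (rule c.borel_measurable_lebesgue_integral) measurable
    show "((\<lambda>t. \<integral>y. dist (cis t) y powr (-s) \<partial>circle_measure) has_integral 2 * I) {0..2*pi}"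
      using has_integral_const_real[of "I / pi" 0 "2 * pi"]
      by (rule has_integral_eq_rhs[OF has_integral_eq[rotated]]) (use inner in auto)
  qed (auto intro: Bochner_Integration.integral_nonneg)
  thus ?thesis by (simp add: I_def)
qed

section \<open>Limit points of sequences with small one-sided steps\<close>

text \<open>
  A real sequence that goes from above \<open>y\<close> to below \<open>y\<close> with small downward steps comes close to \<open>y\<close>,
  however large its upward steps may be: consider the first time it does not exceed \<open>y\<close>.
\<close>

lemma discrete_intermediate_value:
  fixes X :: "nat \<Rightarrow> real"
  assumes "p \<le> q" "X p \<ge> y" "X q \<le> y" "\<And>N. p \<le> N \<Longrightarrow> X (Suc N) \<ge> X N - \<epsilon>" "\<epsilon> \<ge> 0"
  shows "\<exists>N\<ge>p. \<bar>X N - y\<bar> \<le> \<epsilon>"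
proof -
  define N where "N = (LEAST N. p \<le> N \<and> X N \<le> y)"
  have N: "p \<le> N" "X N \<le> y"
    using LeastI[of "\<lambda>N. p \<le> N \<and> X N \<le> y" q] assms unfolding N_def by auto
  show ?thesis
  proof (cases "N = p")
    case True
    thus ?thesis using N assms by (intro exI[of _ N]) auto
  next
    case False
    then obtain K where K: "N = Suc K" "p \<le> K" using N by (cases N) auto
    have "\<not> (p \<le> K \<and> X K \<le> y)"
      by (rule not_less_Least) (use K in \<open>simp add: N_def[symmetric]\<close>)
    hence "X K > y" using K by auto
    thus ?thesis using N K assms(4)[OF K(2)] by (intro exI[of _ N]) auto
  qed
qed

lemma frequently_near_intermediate:
  fixes X :: "nat \<Rightarrow> real"
  assumes pq: "\<And>n. p n \<le> q n" and p: "filterlim p at_top sequentially"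
    and Xp: "(\<lambda>n. X (p n)) \<longlonglongrightarrow> B" and Xq: "(\<lambda>n. X (q n)) \<longlonglongrightarrow> A"
    and step: "\<And>\<epsilon>. \<epsilon> > 0 \<Longrightarrow> eventually (\<lambda>N. X (Suc N) \<ge> X N - \<epsilon>) sequentially"
    and y: "A \<le> y" "y \<le> B" and \<epsilon>: "\<epsilon> > 0"
  shows "\<exists>N\<ge>K. \<bar>X N - y\<bar> < \<epsilon>"
proof -
  obtain K' where K': "\<And>N. N \<ge> K' \<Longrightarrow> X (Suc N) \<ge> X N - \<epsilon> / 2"
    using step[of "\<epsilon> / 2"] \<epsilon> by (auto simp: eventually_at_top_linorder)
  have "eventually (\<lambda>n. p n \<ge> max K K') sequentially"
    using p unfolding filterlim_at_top by blast
  moreover have "eventually (\<lambda>n. X (p n) > B - \<epsilon> / 2) sequentially"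
    by (rule order_tendstoD[OF Xp]) (use \<epsilon> in simp)
  moreover have "eventually (\<lambda>n. X (q n) < A + \<epsilon> / 2) sequentially"
    by (rule order_tendstoD[OF Xq]) (use \<epsilon> in simp)
  ultimately have "eventually (\<lambda>n. p n \<ge> max K K' \<and> X (p n) > B - \<epsilon> / 2 \<and> X (q n) < A + \<epsilon> / 2) sequentially"
    by eventually_elim auto
  then obtain n where n: "p n \<ge> max K K'" "X (p n) > B - \<epsilon> / 2" "X (q n) < A + \<epsilon> / 2"
    by (auto simp: eventually_at_top_linorder)
  consider "X (p n) \<le> y" | "X (q n) \<ge> y" | "X (p n) \<ge> y" "X (q n) \<le> y" by linarith
  thus ?thesis
  proof cases
    case 1
    thus ?thesis using n y \<epsilon> by (intro exI[of _ "p n"]) auto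
  next
    case 2
    thus ?thesis using n y \<epsilon> pq[of n] by (intro exI[of _ "q n"]) auto
  next
    case 3
    have "\<exists>N\<ge>p n. \<bar>X N - y\<bar> \<le> \<epsilon> / 2"
      by (rule discrete_intermediate_value[OF pq 3]) (use K' n \<epsilon> in auto)
    then obtain N where "N \<ge> p n" "\<bar>X N - y\<bar> \<le> \<epsilon> / 2" by blast
    thus ?thesis using n(1) \<epsilon> by (intro exI[of _ N]) auto
  qed
qed

text \<open>
  The index shift in \<open>F\<close> accounts for normalized potentials starting with \<open>N = 1\<close>.
\<close>

lemma limit_points_eq_interval:
  fixes X :: "nat \<Rightarrow> real"
  assumes upper: "\<And>\<epsilon>. \<epsilon> > 0 \<Longrightarrow> eventually (\<lambda>N. X N \<le> B + \<epsilon>) sequentially"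
    and lower: "\<And>\<epsilon>. \<epsilon> > 0 \<Longrightarrow> eventually (\<lambda>N. X N \<ge> A - \<epsilon>) sequentially"
    and near: "\<And>y \<epsilon> K. A \<le> y \<Longrightarrow> y \<le> B \<Longrightarrow> \<epsilon> > 0 \<Longrightarrow> \<exists>N\<ge>K. \<bar>X N - y\<bar> < \<epsilon>"
    and AB: "A \<le> B"
    and F: "\<And>N. F N = ereal (X (Suc N))"
  shows "limit_points F = {liminf F..limsup F} \<and> {liminf F..limsup F} = ereal ` {A..B}"
proof -
  have upperF: "eventually (\<lambda>N. F N \<le> ereal (B + \<epsilon>)) sequentially" if "\<epsilon> > 0" for \<epsilon>
    using eventually_sequentially_Suc[of "\<lambda>N. X N \<le> B + \<epsilon>"] upper[OF that] by (simp add: F)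
  have lowerF: "eventually (\<lambda>N. ereal (A - \<epsilon>) \<le> F N) sequentially" if "\<epsilon> > 0" for \<epsilon>
    using eventually_sequentially_Suc[of "\<lambda>N. A - \<epsilon> \<le> X N"] lower[OF that] by (simp add: F)
  have sup: "limsup F \<le> ereal B"
    by (rule ereal_le_epsilon2) (use Limsup_bounded[OF upperF] in simp)
  have inf: "ereal A \<le> liminf F"
  proof (rule ereal_le_epsilon2)
    fix e :: real assume "e > 0"
    from Liminf_bounded[OF lowerF[OF this]] show "ereal A \<le> liminf F + ereal e"
      by (cases "liminf F") auto
  qed
  have lp: "ereal y \<in> limit_points F" if y: "A \<le> y" "y \<le> B" for y
  proof -
    define P where "P = (\<lambda>n N. \<bar>X (Suc N) - y\<bar> < 1 / real (Suc n))"
    have ex: "\<exists>N>K. P n N" for K n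
    proof -
      obtain N where "N \<ge> Suc (Suc K)" "\<bar>X N - y\<bar> < 1 / real (Suc n)"
        using near[OF y, of "1 / real (Suc n)" "Suc (Suc K)"] by auto
      thus ?thesis by (intro exI[of _ "N - 1"]) (auto simp: P_def)
    qed
    have "\<exists>r. \<forall>n. P n (r n) \<and> r n < r (Suc n)"
      by (rule dependent_nat_choice) (use ex in blast)+
    then obtain r where r: "\<And>n. P n (r n)" "\<And>n. r n < r (Suc n)" by blast
    have "(\<lambda>n. X (Suc (r n)) - y) \<longlonglongrightarrow> 0"
    proof (rule Lim_null_comparison)
      show "eventually (\<lambda>n. norm (X (Suc (r n)) - y) \<le> 1 / real (Suc n)) sequentially"
        using r(1) by (intro always_eventually) (auto simp: P_def intro: less_imp_le)
      show "(\<lambda>n. 1 / real (Suc n)) \<longlonglongrightarrow> 0" by real_asymp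
    qed
    hence "(F \<circ> r) \<longlonglongrightarrow> ereal y" by (simp add: F o_def LIM_zero_iff)
    moreover have "strict_mono r" using r(2) by (simp add: strict_mono_Suc_iff)
    ultimately show ?thesis unfolding limit_points_def by blast
  qed
  have bounds: "liminf F \<le> l \<and> l \<le> limsup F" if "l \<in> limit_points F" for l
  proof -
    obtain r where r: "strict_mono r" "(F \<circ> r) \<longlonglongrightarrow> l" using \<open>l \<in> limit_points F\<close> unfolding limit_points_def by blast
    have "liminf (F \<circ> r) = l" "limsup (F \<circ> r) = l"
      using lim_imp_Liminf[OF sequentially_bot r(2)] lim_imp_Limsup[OF sequentially_bot r(2)] by auto
    thus ?thesis using liminf_subseq_mono[OF r(1), of F] limsup_subseq_mono[OF r(1), of F] by simp
  qed
  have "liminf F = ereal A" "limsup F = ereal B"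
    using bounds[OF lp[of A]] bounds[OF lp[of B]] AB inf sup by (auto intro: antisym)
  moreover have "{ereal A..ereal B} = ereal ` {A..B}"
  proof
    show "{ereal A..ereal B} \<subseteq> ereal ` {A..B}"
    proof
      fix x assume "x \<in> {ereal A..ereal B}"
      thus "x \<in> ereal ` {A..B}" by (cases x) auto
    qed
  qed auto
  moreover have "limit_points F = {ereal A..ereal B}"
    using bounds lp calculation by auto
  ultimately show ?thesis by simp
qed

section \<open>Greedy values with a convex profile\<close>

text \<open>
  The common core of the cases \<open>s > 0\<close>. The greedy value \<open>binsum w N\<close>, centred by \<open>G N\<close> and divided by
  \<open>N powr s\<close>, has limit points filling \<open>[A, B]\<close>. The digit weights \<open>w n\<close> are, up to a negligible
  error \<open>e n\<close>, a linear function plus \<open>c\<close> times a convex function \<open>\<phi>\<close> of \<open>2 ^ n\<close>. By the self-similarity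
  assumption they are likewise a linear function plus \<open>c'\<close> times the increment of \<open>\<phi>\<close> over
  \<open>[2 ^ n, 2 ^ (n + 1)]\<close>. The first description shows with \<open>binsum_convex_le\<close> that the
  sequence is asymptotically at most \<open>B\<close>, with limit \<open>B\<close> along the powers of two. The second one
  shows with \<open>binsum_convex_ge\<close> that it is asymptotically at least \<open>A\<close>, with limit \<open>A\<close> along
  \<open>2 ^ (n + 1) - 1\<close>. As the greedy values increase, the downward steps of the sequence tend to zero,
  so that on its way from \<open>2 ^ n\<close> to \<open>2 ^ (n + 1) - 1\<close> it approaches every value in between.
\<close>

lemma dyadic_limit_interval:
  fixes w e G X :: "nat \<Rightarrow> real" and \<phi> :: "real \<Rightarrow> real"
  assumes s: "s > 0" and conv: "convex_on {0..} \<phi>" "\<phi> 0 = 0" and c: "c \<ge> 0" "c' \<ge> 0"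
    and w: "\<And>n. w n = \<kappa> * 2 ^ n + c * \<phi> (2 ^ n) + e n"
    and e: "(\<lambda>n. e n / (2 ^ n) powr s) \<longlonglongrightarrow> 0"
    and self: "\<And>n. c * \<phi> (2 ^ n) = c' * (\<phi> (2 ^ Suc n) - \<phi> (2 ^ n)) + \<mu> * 2 ^ n"
    and X: "\<And>N. X N = (binsum w N - G N) / real N powr s"
    and B: "\<And>N. N > 0 \<Longrightarrow> B * real N powr s = \<kappa> * real N + c * \<phi> (real N) - G N"
    and A: "\<And>N. N > 0 \<Longrightarrow> A * real N powr s = (\<kappa> + \<mu>) * real N + c' * \<phi> (real N) - G N"
    and gap: "((\<lambda>x. (\<phi> x - \<phi> 1 - \<phi> (x - 1)) / (x - 1) powr s) \<longlongrightarrow> 0) at_top"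
    and mono: "\<And>N. binsum w N \<le> binsum w (Suc N)"
    and G: "(\<lambda>N. (G (Suc N) - G N) / real (Suc N) powr s) \<longlonglongrightarrow> 0"
    and F: "\<And>N. F N = ereal (X (Suc N))"
  shows "limit_points F = {liminf F..limsup F} \<and> {liminf F..limsup F} = ereal ` {A..B}"
proof -
  define E where "E = (\<lambda>N. binsum e N / real N powr s)"
  have E: "E \<longlonglongrightarrow> 0" unfolding E_def by (rule binsum_small_o[OF s e])
  define \<Phi> where "\<Phi> = binsum (\<lambda>n. \<phi> (2 ^ n))"
  define \<Delta> where "\<Delta> = binsum (\<lambda>n. \<phi> (2 ^ Suc n) - \<phi> (2 ^ n))"
  have bw: "binsum w N = \<kappa> * real N + c * \<Phi> N + binsum e N" for N
    unfolding w \<Phi>_def by (simp add: binsum_add binsum_mult binsum_two_power)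
  have b\<Phi>: "c * \<Phi> N = c' * \<Delta> N + \<mu> * real N" for N
    unfolding \<Phi>_def \<Delta>_def binsum_mult[symmetric] self
    by (simp only: binsum_add binsum_mult binsum_two_power)
  have XB: "X N = B + c * (\<Phi> N - \<phi> (real N)) / real N powr s + E N" if "N > 0" for N
  proof -
    have "B = (\<kappa> * real N + c * \<phi> (real N) - G N) / real N powr s" using B[OF that] that by (simp add: field_simps)
    thus ?thesis by (simp add: X bw E_def diff_divide_distrib add_divide_distrib right_diff_distrib)
  qed
  have XA: "X N = A + c' * (\<Delta> N - \<phi> (real N)) / real N powr s + E N" if "N > 0" for N
  proof -
    have "A = ((\<kappa> + \<mu>) * real N + c' * \<phi> (real N) - G N) / real N powr s" using A[OF that] that by (simp add: field_simps)
    thus ?thesis by (simp add: X bw b\<Phi> E_def diff_divide_distrib add_divide_distrib right_diff_distrib distrib_right)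
  qed
  have up: "X N \<le> B + E N" if "N > 0" for N
  proof -
    have "c * (\<Phi> N - \<phi> (real N)) / real N powr s \<le> 0"
      using binsum_convex_le[OF conv, of N] c
      by (intro divide_nonpos_nonneg mult_nonneg_nonpos) (auto simp: \<Phi>_def)
    thus ?thesis using XB[OF that] by simp
  qed
  have low: "X N \<ge> A + E N" if "N > 0" for N
  proof -
    have "c' * (\<Delta> N - \<phi> (real N)) / real N powr s \<ge> 0"
      using binsum_convex_ge[OF conv, of N] c
      by (intro divide_nonneg_nonneg mult_nonneg_nonneg) (auto simp: \<Delta>_def)
    thus ?thesis using XA[OF that] by simp
  qed
  have upper: "eventually (\<lambda>N. X N \<le> B + \<epsilon>) sequentially" if "\<epsilon> > 0" for \<epsilon>
    using order_tendstoD(2)[OF E that] eventually_gt_at_top[of 0]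
  proof eventually_elim
    case (elim N)
    thus ?case using up[of N] by linarith
  qed
  have lower: "eventually (\<lambda>N. X N \<ge> A - \<epsilon>) sequentially" if "\<epsilon> > 0" for \<epsilon>
  proof -
    have "eventually (\<lambda>N. E N > - \<epsilon>) sequentially" by (rule order_tendstoD(1)[OF E]) (use that in simp)
    thus ?thesis using eventually_gt_at_top[of 0]
    proof eventually_elim
      case (elim N)
      thus ?case using low[of N] by linarith
    qed
  qed
  have p: "filterlim (\<lambda>n. (2::nat) ^ n) at_top sequentially"
    by (rule filterlim_subseq) (auto simp: strict_mono_def)
  have q: "filterlim (\<lambda>n. (2::nat) ^ Suc n - 1) at_top sequentially"
    by (rule filterlim_subseq) (auto simp: strict_mono_Suc_iff intro!: diff_less_mono)
  have XP: "(\<lambda>n. X (2 ^ n)) \<longlonglongrightarrow> B"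
  proof -
    have "X (2 ^ n) = B + E (2 ^ n)" for n by (simp add: XB \<Phi>_def binsum_exp)
    thus ?thesis using tendsto_add[OF tendsto_const filterlim_compose[OF E p], of B] by simp
  qed
  have XQ: "(\<lambda>n. X (2 ^ Suc n - 1)) \<longlonglongrightarrow> A"
  proof -
    have r: "real (2 ^ Suc n - 1) = 2 ^ Suc n - 1" for n by (simp add: of_nat_diff)
    have d: "\<Delta> (2 ^ Suc n - 1) = \<phi> (2 ^ Suc n) - \<phi> 1" for n
      using sum_lessThan_telescope[of "\<lambda>k. \<phi> (2 ^ k)" "Suc n"]
      by (simp only: \<Delta>_def binsum_mask power_0)
    have pos: "(2::nat) ^ Suc n - 1 > 0" for n using one_less_power[of "2::nat" "Suc n"] by simp
    have eq: "X (2 ^ Suc n - 1) = A + c' * ((\<phi> (2 ^ Suc n) - \<phi> 1 - \<phi> (2 ^ Suc n - 1)) / (2 ^ Suc n - 1) powr s)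
        + E (2 ^ Suc n - 1)" for n
      unfolding XA[OF pos] d r by simp
    have "filterlim (\<lambda>n. (2::real) ^ Suc n) at_top sequentially" by real_asymp
    from filterlim_compose[OF gap this]
    have "(\<lambda>n. A + c' * ((\<phi> (2 ^ Suc n) - \<phi> 1 - \<phi> (2 ^ Suc n - 1)) / (2 ^ Suc n - 1) powr s)
        + E (2 ^ Suc n - 1)) \<longlonglongrightarrow> A + c' * 0 + 0"
      by (intro tendsto_add tendsto_mult tendsto_const filterlim_compose[OF E q])
    thus ?thesis unfolding eq by simp
  qed
  have AB: "A \<le> B"
  proof (rule LIMSEQ_le)
    show "(\<lambda>n. A + E (2 ^ n)) \<longlonglongrightarrow> A"
      using tendsto_add[OF tendsto_const filterlim_compose[OF E p], of A] by simp
    show "\<exists>N. \<forall>n\<ge>N. A + E (2 ^ n) \<le> X (2 ^ n)" using low by auto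
  qed (rule XP)
  have step: "eventually (\<lambda>N. X (Suc N) \<ge> X N - \<epsilon>) sequentially" if \<epsilon>: "\<epsilon> > 0" for \<epsilon>
  proof -
    define K where "K = \<bar>A\<bar> + \<bar>B\<bar> + 1"
    have "(\<lambda>N. 1 - real N powr s / real (Suc N) powr s) \<longlonglongrightarrow> 0" using s by real_asymp
    from tendsto_add[OF tendsto_mult[OF tendsto_const[of K] this] G]
    have "eventually (\<lambda>N. K * (1 - real N powr s / real (Suc N) powr s) + (G (Suc N) - G N) / real (Suc N) powr s < \<epsilon>) sequentially"
      using \<epsilon> by (intro order_tendstoD) auto
    thus ?thesis
      using upper[of 1, simplified] lower[of 1, simplified] eventually_gt_at_top[of 0]
    proof eventually_elim
      case (elim N)
      define r where "r = real N powr s / real (Suc N) powr s"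
      have "real N powr s \<le> real (Suc N) powr s" using s by (intro powr_mono2) auto
      hence r: "r \<le> 1" by (simp add: r_def)
      have "X N \<le> K" using elim by (auto simp: K_def)
      hence "X N * (1 - r) \<le> K * (1 - r)" using r by (intro mult_right_mono) auto
      moreover have "X N * r = (binsum w N - G N) / real (Suc N) powr s"
        using elim by (simp add: X r_def)
      moreover have "(binsum w N - G N) / real (Suc N) powr s - (G (Suc N) - G N) / real (Suc N) powr s \<le> X (Suc N)"
        unfolding X diff_divide_distrib[symmetric] using mono[of N] by (intro divide_right_mono) auto
      moreover note elim(1)[folded r_def]
      ultimately show ?case unfolding right_diff_distrib by linarith
    qed
  qed
  show ?thesis
  proof (rule limit_points_eq_interval[OF upper lower _ AB F])
    fix y \<epsilon> :: real and K :: nat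
    assume "A \<le> y" "y \<le> B" "\<epsilon> > 0"
    thus "\<exists>N\<ge>K. \<bar>X N - y\<bar> < \<epsilon>"
      by (intro frequently_near_intermediate[OF _ p XP XQ step]) auto
  qed auto
qed

text \<open>
  The endpoint \<open>0\<close> has to be treated by hand because the derivatives of the functions in question
  may be singular there.
\<close>

lemma convex_on_extend_0:
  fixes f :: "real \<Rightarrow> real"
  assumes conv: "convex_on {0<..} f" and 0: "f 0 = 0"
    and star: "\<And>t y. 0 < t \<Longrightarrow> t < 1 \<Longrightarrow> y > 0 \<Longrightarrow> f (t * y) \<le> t * f y"
  shows "convex_on {0..} f"
proof (rule convex_onI)
  fix t x y :: real
  assume t: "0 < t" "t < 1" and xy: "x \<in> {0..}" "y \<in> {0..}"
  consider "x = 0" "y = 0" | "x = 0" "y > 0" | "x > 0" "y = 0" | "x > 0" "y > 0" using xy by fastforce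
  thus "f ((1 - t) *\<^sub>R x + t *\<^sub>R y) \<le> (1 - t) * f x + t * f y"
  proof cases
    case 4
    thus ?thesis using convex_onD[OF conv, of t x y] t by auto
  qed (use 0 t star[of t y] star[of "1 - t" x] in auto)
qed auto

lemma convex_on_powr_ge_1:
  assumes "s \<ge> 1"
  shows "convex_on {0..} (\<lambda>x. x powr s)"
proof (rule convex_on_extend_0[OF powr_convex[OF assms]])
  fix t y :: real assume t: "0 < t" "t < 1" "y > 0"
  have "t powr s \<le> t powr 1" using t assms by (intro powr_mono') auto
  thus "(t * y) powr s \<le> t * y powr s" using t by (simp add: powr_mult)
qed auto

lemma convex_on_neg_powr:
  assumes "0 < s" "s < 1"
  shows "convex_on {0..} (\<lambda>x. - (x powr s))"
proof (rule convex_on_extend_0)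
  show "convex_on {0<..} (\<lambda>x. - (x powr s))"
  proof (rule f''_ge0_imp_convex)
    fix x :: real assume x: "x \<in> {0<..}"
    show "((\<lambda>x. - (x powr s)) has_real_derivative - (s * x powr (s - 1))) (at x)"
      using x by (auto intro!: derivative_eq_intros)
    show "((\<lambda>x. - (s * x powr (s - 1))) has_real_derivative s * (1 - s) * x powr (s - 2)) (at x)"
      using x by (auto intro!: derivative_eq_intros simp: algebra_simps)
    show "0 \<le> s * (1 - s) * x powr (s - 2)" using assms by simp
  qed auto
next
  fix t y :: real assume t: "0 < t" "t < 1" "y > 0"
  have "t powr 1 \<le> t powr s" using t assms by (intro powr_mono') auto
  thus "- ((t * y) powr s) \<le> t * - (y powr s)" using t by (simp add: powr_mult)
qed auto

lemma convex_on_mult_ln: "convex_on {0..} (\<lambda>x::real. x * ln x)"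
proof (rule convex_on_extend_0)
  show "convex_on {0<..} (\<lambda>x::real. x * ln x)"
  proof (rule f''_ge0_imp_convex)
    fix x :: real assume x: "x \<in> {0<..}"
    show "((\<lambda>x. x * ln x) has_real_derivative ln x + 1) (at x)"
      using x by (auto intro!: derivative_eq_intros)
    show "((\<lambda>x. ln x + 1) has_real_derivative 1 / x) (at x)"
      using x by (auto intro!: derivative_eq_intros)
    show "0 \<le> 1 / x" using x by simp
  qed auto
next
  fix t y :: real assume t: "0 < t" "t < 1" "y > 0"
  have "t * y * ln t \<le> 0" using t by (intro mult_nonneg_nonpos) auto
  thus "t * y * ln (t * y) \<le> t * (y * ln y)" using t by (simp add: ln_mult algebra_simps)
qed auto

lemma limit_along_powers_of_two:
  fixes h :: "nat \<Rightarrow> real"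
  assumes "(\<lambda>m. h (2 * m)) \<longlonglongrightarrow> L"
  shows "(\<lambda>n. h (2 ^ n)) \<longlonglongrightarrow> L"
proof (rule LIMSEQ_imp_Suc)
  have p: "filterlim (\<lambda>n. (2::nat) ^ n) at_top sequentially"
    by (rule filterlim_subseq) (auto simp: strict_mono_def)
  show "(\<lambda>n. h (2 ^ Suc n)) \<longlonglongrightarrow> L"
    using filterlim_compose[OF assms p] by simp
qed

lemma greedy_value_mono:
  assumes "s > 0" "greedy_energy_sequence s a"
  shows "greedy_value s N \<le> greedy_value s (Suc N)"
proof -
  have "kernel_profile s 2 \<ge> 0" using assms by (simp add: kernel_profile_def)
  thus ?thesis using greedy_value_Suc_ge[of s a N] assms by linarith
qed

section \<open>The limit points of the normalized potentials\<close>

text \<open>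
  Each digit of \<open>N\<close> contributes \<open>- ln 2\<close>, so the normalized potential is the number of digits \<open>1\<close> of \<open>N\<close>,
  divided by the binary logarithm of \<open>N + 1\<close>. In contrast to the case \<open>s > 0\<close> it rises from \<open>0\<close> to \<open>1\<close>
  between \<open>2 ^ n\<close> and \<open>2 ^ (n + 1) - 1\<close>, with small upward steps, so the intermediate value
  argument is applied to its negative.
\<close>

lemma limit_points_0:
  assumes g: "greedy_energy_sequence 0 a" and F: "\<And>N. F N = normalized_potential 0 a (Suc N)"
  shows "limit_points F = {liminf F..limsup F} \<and> {liminf F..limsup F} = ereal ` {0..1}"
proof -
  define v where "v = binsum (\<lambda>_. ln 2)"
  define X where "X = (\<lambda>N. v N / ln (real N + 1))"
  have gv: "greedy_value 0 N = - v N" for N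
    using binsum_mult[of "-1" "\<lambda>_. ln 2" N] by (simp add: greedy_value_def midpoint_potential_0 v_def)
  have v0: "v N \<ge> 0" for N unfolding v_def binsum_def by (intro sum_nonneg) auto
  have v1: "v N \<le> ln (real N + 1)" for N
    unfolding v_def
  proof (rule binsum_le)
    fix n j :: nat assume "j < 2 ^ n"
    hence "real (2 * (j + 1)) \<le> real (2 ^ n + j + 1)" by (intro of_nat_mono) simp
    hence "ln (2 * (real j + 1)) \<le> ln (real (2 ^ n + j) + 1)" by (subst ln_le_cancel_iff) auto
    moreover have "ln (2 * (real j + 1)) = ln 2 + ln (real j + 1)" by (rule ln_mult_pos) auto
    ultimately show "ln 2 + ln (real j + 1) \<le> ln (real (2 ^ n + j) + 1)" by linarith
  qed auto
  have FX: "F N = ereal (X (Suc N))" for N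
    using greedy_potential[OF _ g, of "Suc N"] by (simp add: F normalized_potential_def gv X_def)
  have X01: "0 \<le> X N \<and> X N \<le> 1" for N
    using v0[of N] v1[of N] by (cases "N = 0") (auto simp: X_def divide_simps)
  have step: "eventually (\<lambda>N. - X (Suc N) \<ge> - X N - \<epsilon>) sequentially" if \<epsilon>: "\<epsilon> > 0" for \<epsilon>
  proof -
    have "(\<lambda>N. ln 2 / ln (real N + 2)) \<longlonglongrightarrow> 0" by real_asymp
    hence "eventually (\<lambda>N. ln 2 / ln (real N + 2) < \<epsilon>) sequentially" using \<epsilon> by (rule order_tendstoD)
    thus ?thesis using eventually_gt_at_top[of 0]
    proof eventually_elim
      case (elim N)
      have "v (Suc N) \<le> v N + ln 2"
        using greedy_value_Suc_ge[OF _ g, of N] by (simp add: gv kernel_profile_def)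
      hence "X (Suc N) \<le> (v N + ln 2) / ln (real N + 2)"
        unfolding X_def by (simp add: divide_right_mono add.commute)
      also have "\<dots> \<le> v N / ln (real N + 1) + ln 2 / ln (real N + 2)"
        unfolding add_divide_distrib using v0[of N] elim by (intro add_right_mono divide_left_mono) auto
      finally show ?case using elim by (simp add: X_def)
    qed
  qed
  have p: "filterlim (\<lambda>n. (2::nat) ^ n) at_top sequentially"
    by (rule filterlim_subseq) (auto simp: strict_mono_def)
  have Xp: "(\<lambda>n. - X (2 ^ n)) \<longlonglongrightarrow> 0"
  proof -
    have "(\<lambda>n. - (ln 2 / ln (2 ^ n + 1))) \<longlonglongrightarrow> (0::real)" by real_asymp
    thus ?thesis by (simp add: X_def v_def binsum_exp)
  qed
  have Xq: "(\<lambda>n. - X (2 ^ Suc n - 1)) \<longlonglongrightarrow> -1"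
  proof -
    have "X (2 ^ Suc n - 1) = 1" for n
    proof -
      have "v (2 ^ Suc n - 1) = real (Suc n) * ln 2" unfolding v_def binsum_mask by simp
      moreover have "ln (real (2 ^ Suc n - 1) + 1) = real (Suc n) * ln 2"
        by (subst ln_realpow[symmetric]) (auto simp: of_nat_diff)
      ultimately show ?thesis by (simp add: X_def)
    qed
    thus ?thesis by simp
  qed
  show ?thesis
  proof (rule limit_points_eq_interval[where X = X])
    fix y \<epsilon> :: real and K :: nat
    assume y: "0 \<le> y" "y \<le> 1" "\<epsilon> > 0"
    have "\<exists>N\<ge>K. \<bar>- X N - (- y)\<bar> < \<epsilon>"
      by (rule frequently_near_intermediate[OF _ p Xp Xq step]) (use y in auto)
    thus "\<exists>N\<ge>K. \<bar>X N - y\<bar> < \<epsilon>" by (simp add: abs_minus_commute)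
  next
    fix \<epsilon> :: real assume "\<epsilon> > 0"
    hence "X N \<le> 1 + \<epsilon>" "0 - \<epsilon> \<le> X N" for N using X01[of N] by linarith+
    thus "eventually (\<lambda>N. X N \<le> 1 + \<epsilon>) sequentially" "eventually (\<lambda>N. 0 - \<epsilon> \<le> X N) sequentially"
      by (auto intro!: always_eventually)
  qed (auto simp: FX)
qed

text \<open>
  Here the convex function is \<open>- (x powr s)\<close>. The constants \<open>c = - B\<close> and \<open>c' = - A\<close> are nonnegative since
  the zeta function is not positive on \<open>(0, 1)\<close>; they are related by the scaling of \<open>x powr s\<close> under
  doubling. The linear part of the weights is exactly what the energy of the circle cancels.
\<close>

lemma limit_points_less_1:
  assumes s: "0 < s" "s < 1"
    and g: "greedy_energy_sequence s a" and F: "\<And>N. F N = normalized_potential s a (Suc N)"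
  shows "limit_points F = {liminf F..limsup F} \<and> {liminf F..limsup F} =
     ereal ` {2 * (2 * pi) powr (-s) * Re (riemann_zeta (of_real s)) ..
              2 * (2 powr s - 1) * (2 * pi) powr (-s) * Re (riemann_zeta (of_real s))}"
proof -
  define I where "I = riesz_energy s"
  define A where "A = 2 * (2 * pi) powr (-s) * Re (riemann_zeta (of_real s))"
  define B where "B = 2 * (2 powr s - 1) * (2 * pi) powr (-s) * Re (riemann_zeta (of_real s))"
  have BA: "B = (2 powr s - 1) * A" by (simp add: A_def B_def)
  have A0: "A \<le> 0" using riemann_zeta_nonpos[OF s] by (simp add: A_def mult_nonneg_nonpos)
  have two: "2 powr s > 1" using s by simp
  define e where "e = (\<lambda>n. midpoint_potential s (2 ^ n) - I * 2 ^ n - B * (2 ^ n) powr s)"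
  have lim: "(\<lambda>n. midpoint_potential s (2 ^ n) / real (2 ^ n) powr s - real (2 ^ n) powr (1 - s) * I) \<longlonglongrightarrow> B"
    by (rule limit_along_powers_of_two)
       (use midpoint_potential_limit_less_1[OF s] in \<open>simp add: I_def riesz_energy_eq[OF s] B_def\<close>)
  show ?thesis unfolding A_def[symmetric] B_def[symmetric]
  proof (rule dyadic_limit_interval[where s = s and \<phi> = "\<lambda>x. - (x powr s)" and c = "-B" and c' = "-A"
        and \<kappa> = I and \<mu> = 0 and G = "\<lambda>N. I * real N" and e = e
        and w = "\<lambda>n. midpoint_potential s (2 ^ n)"
        and X = "\<lambda>N. (greedy_value s N - I * real N) / real N powr s"])
    show "convex_on {0..} (\<lambda>x. - (x powr s))" by (rule convex_on_neg_powr[OF s])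
    show "0 \<le> - B" using A0 two by (simp add: BA mult_nonneg_nonpos)
    show "(\<lambda>n. e n / (2 ^ n) powr s) \<longlonglongrightarrow> 0"
    proof -
      have "e n / (2 ^ n) powr s = midpoint_potential s (2 ^ n) / real (2 ^ n) powr s - real (2 ^ n) powr (1 - s) * I - B" for n
        by (simp add: e_def diff_divide_distrib powr_diff)
      thus ?thesis using tendsto_diff[OF lim tendsto_const[of B]] by simp
    qed
    show "- B * - ((2 ^ n) powr s) = - A * (- ((2 ^ Suc n) powr s) - - ((2 ^ n) powr s)) + 0 * 2 ^ n" for n
      by (simp add: BA powr_mult algebra_simps)
    show "((\<lambda>x. (- (x powr s) - - (1 powr s) - - ((x - 1) powr s)) / (x - 1) powr s) \<longlongrightarrow> 0) at_top"
      using s by real_asymp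
    show "(\<lambda>N. (I * real (Suc N) - I * real N) / real (Suc N) powr s) \<longlonglongrightarrow> 0"
    proof -
      have "(\<lambda>N. I / real (Suc N) powr s) \<longlonglongrightarrow> 0" using s by real_asymp
      thus ?thesis by (simp add: algebra_simps)
    qed
    show "F N = ereal ((greedy_value s (Suc N) - I * real (Suc N)) / real (Suc N) powr s)" for N
      using greedy_potential[OF _ g, of "Suc N"] s
      by (simp add: F normalized_potential_def I_def mult.commute)
    show "binsum (\<lambda>n. midpoint_potential s (2 ^ n)) N \<le> binsum (\<lambda>n. midpoint_potential s (2 ^ n)) (Suc N)" for N
      using greedy_value_mono[OF s(1) g] by (simp add: greedy_value_def)
  qed (use s A0 in \<open>auto simp: e_def greedy_value_def\<close>)
qed

text \<open>
  Here the convex function is \<open>x powr s\<close>, and any linear part of the weights is of lower order.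
\<close>

lemma limit_points_greater_1:
  assumes s: "s > 1"
    and g: "greedy_energy_sequence s a" and F: "\<And>N. F N = normalized_potential s a (Suc N)"
  shows "limit_points F = {liminf F..limsup F} \<and> {liminf F..limsup F} =
     ereal ` {2 * (2 * pi) powr (-s) * Re (riemann_zeta (of_real s)) ..
              2 * (2 powr s - 1) * (2 * pi) powr (-s) * Re (riemann_zeta (of_real s))}"
proof -
  define A where "A = 2 * (2 * pi) powr (-s) * Re (riemann_zeta (of_real s))"
  define B where "B = 2 * (2 powr s - 1) * (2 * pi) powr (-s) * Re (riemann_zeta (of_real s))"
  have BA: "B = (2 powr s - 1) * A" by (simp add: A_def B_def)
  have A0: "A \<ge> 0" using riemann_zeta_nonneg[OF s] by (simp add: A_def)
  have two: "2 powr s > 1" using s by simp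
  define e where "e = (\<lambda>n. midpoint_potential s (2 ^ n) - B * (2 ^ n) powr s)"
  have lim: "(\<lambda>n. midpoint_potential s (2 ^ n) / real (2 ^ n) powr s) \<longlonglongrightarrow> B"
    by (rule limit_along_powers_of_two)
       (use midpoint_potential_limit_greater_1[OF s] in \<open>simp add: B_def\<close>)
  show ?thesis unfolding A_def[symmetric] B_def[symmetric]
  proof (rule dyadic_limit_interval[where s = s and \<phi> = "\<lambda>x. x powr s" and c = B and c' = A
        and \<kappa> = 0 and \<mu> = 0 and G = "\<lambda>_. 0" and e = e
        and w = "\<lambda>n. midpoint_potential s (2 ^ n)"
        and X = "\<lambda>N. greedy_value s N / real N powr s"])
    show "convex_on {0..} (\<lambda>x. x powr s)" using s by (intro convex_on_powr_ge_1) auto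
    show "0 \<le> B" using A0 two by (simp add: BA)
    show "(\<lambda>n. e n / (2 ^ n) powr s) \<longlonglongrightarrow> 0"
    proof -
      have "e n / (2 ^ n) powr s = midpoint_potential s (2 ^ n) / real (2 ^ n) powr s - B" for n
        by (simp add: e_def diff_divide_distrib)
      thus ?thesis using tendsto_diff[OF lim tendsto_const[of B]] by simp
    qed
    show "B * (2 ^ n) powr s = A * ((2 ^ Suc n) powr s - (2 ^ n) powr s) + 0 * 2 ^ n" for n
      by (simp add: BA powr_mult algebra_simps)
    show "((\<lambda>x. (x powr s - 1 powr s - (x - 1) powr s) / (x - 1) powr s) \<longlongrightarrow> 0) at_top"
      using s by real_asymp
    show "F N = ereal (greedy_value s (Suc N) / real (Suc N) powr s)" for N
      using greedy_potential[OF _ g, of "Suc N"] s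
      by (simp add: F normalized_potential_def)
    show "binsum (\<lambda>n. midpoint_potential s (2 ^ n)) N \<le> binsum (\<lambda>n. midpoint_potential s (2 ^ n)) (Suc N)" for N
      using greedy_value_mono[OF _ g] s by (simp add: greedy_value_def)
  qed (use s A0 in \<open>auto simp: e_def greedy_value_def\<close>)
qed

text \<open>
  Here the convex function is \<open>x * ln x\<close>. Doubling turns it into twice itself plus the linear function
  \<open>2 * ln 2 * x\<close>; this is the reason why the two endpoints differ by \<open>2 * ln 2 / pi\<close>.
\<close>

lemma limit_points_1:
  assumes g: "greedy_energy_sequence 1 a" and F: "\<And>N. F N = normalized_potential 1 a (Suc N)"
  shows "limit_points F = {liminf F..limsup F} \<and> {liminf F..limsup F} =
     ereal ` {1 / pi * (euler_mascheroni + ln (2 / pi)) .. 1 / pi * (euler_mascheroni + ln (8 / pi))}"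
proof -
  define A :: real where "A = 1 / pi * (euler_mascheroni + ln (2 / pi))"
  define B :: real where "B = 1 / pi * (euler_mascheroni + ln (8 / pi))"
  have BA: "A = B - 2 * ln 2 / pi"
  proof -
    have "ln (8 / pi) = ln (2 ^ 2 * (2 / pi))" by simp
    also have "\<dots> = ln (2 ^ 2) + ln (2 / pi)" by (rule ln_mult_pos) auto
    also have "ln (2 ^ 2) = 2 * ln (2 :: real)" by (subst ln_realpow) auto
    finally show ?thesis by (simp add: A_def B_def field_simps)
  qed
  define e where "e = (\<lambda>n. midpoint_potential 1 (2 ^ n) - B * 2 ^ n - 1 / pi * (2 ^ n * ln (2 ^ n)))"
  have lim: "(\<lambda>n. midpoint_potential 1 (2 ^ n) / real (2 ^ n) - ln (real (2 ^ n)) / pi) \<longlonglongrightarrow> B"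
    by (rule limit_along_powers_of_two)
       (use midpoint_potential_limit_1 in \<open>simp add: B_def\<close>)
  show ?thesis unfolding A_def[symmetric] B_def[symmetric]
  proof (rule dyadic_limit_interval[where s = 1 and \<phi> = "\<lambda>x. x * ln x" and c = "1 / pi" and c' = "1 / pi"
        and \<kappa> = B and \<mu> = "- 2 * ln 2 / pi" and G = "\<lambda>N. 1 / pi * real N * ln (real N)" and e = e
        and w = "\<lambda>n. midpoint_potential 1 (2 ^ n)"
        and X = "\<lambda>N. (greedy_value 1 N - 1 / pi * real N * ln (real N)) / real N powr 1"])
    show "convex_on {0..} (\<lambda>x::real. x * ln x)" by (rule convex_on_mult_ln)
    show "(\<lambda>n. e n / (2 ^ n) powr 1) \<longlonglongrightarrow> 0"
    proof -
      have "e n / (2 ^ n) powr 1 = midpoint_potential 1 (2 ^ n) / real (2 ^ n) - ln (real (2 ^ n)) / pi - B" for n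
        by (simp add: e_def diff_divide_distrib)
      thus ?thesis using tendsto_diff[OF lim tendsto_const[of B]] by simp
    qed
    show "1 / pi * (2 ^ n * ln (2 ^ n)) =
        1 / pi * (2 ^ Suc n * ln (2 ^ Suc n) - 2 ^ n * ln (2 ^ n)) + - 2 * ln 2 / pi * 2 ^ n" for n
    proof -
      have "ln (2 ^ Suc n) = ln 2 + ln (2 ^ n :: real)" by (simp add: ln_mult)
      thus ?thesis by (simp add: field_simps)
    qed
    show "((\<lambda>x::real. (x * ln x - 1 * ln 1 - (x - 1) * ln (x - 1)) / (x - 1) powr 1) \<longlongrightarrow> 0) at_top"
      by real_asymp
    show "(\<lambda>N. (1 / pi * real (Suc N) * ln (real (Suc N)) - 1 / pi * real N * ln (real N)) / real (Suc N) powr 1) \<longlonglongrightarrow> 0"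
      by real_asymp
    show "F N = ereal ((greedy_value 1 (Suc N) - 1 / pi * real (Suc N) * ln (real (Suc N))) / real (Suc N) powr 1)" for N
      using greedy_potential[OF _ g, of "Suc N"]
      by (simp add: F normalized_potential_def)
    show "binsum (\<lambda>n. midpoint_potential 1 (2 ^ n)) N \<le> binsum (\<lambda>n. midpoint_potential 1 (2 ^ n)) (Suc N)" for N
      using greedy_value_mono[OF _ g] by (simp add: greedy_value_def)
  qed (auto simp: e_def greedy_value_def BA field_simps)
qed

theorem theorem1p3:
  fixes s :: real and a :: "nat \<Rightarrow> complex" and F :: "nat \<Rightarrow> ereal"
  assumes "s \<ge> 0"
    and "greedy_energy_sequence s a"
  assumes F: "\<And>N. F N = normalized_potential s a (Suc N)"
  shows "limit_points F = {liminf F..limsup F} \<and>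
         {liminf F..limsup F} = ereal ` limit_interval s"
proof -
  consider "s = 0" | "0 < s" "s < 1" | "s = 1" | "s > 1" using assms(1) by linarith
  thus ?thesis
  proof cases
    case 1
    thus ?thesis using limit_points_0[of a F] assms by (simp add: limit_interval_def)
  next
    case 2
    thus ?thesis using limit_points_less_1[OF 2 assms(2) F] by (simp add: limit_interval_def)
  next
    case 3
    thus ?thesis using limit_points_1[of a F] assms by (simp add: limit_interval_def)
  next
    case 4
    thus ?thesis using limit_points_greater_1[OF 4 assms(2) F] by (simp add: limit_interval_def)
  qed
qed

end
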